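(* Let $p,q\in(0,1]$ and let $\mathcal P_h^+$ be the heralding coin process with parameters $p,q$ and causal states $s_0^+,s_1^+$. Define $\mathcal Q^+=(\varepsilon_q^+,\Omega^+,\mathcal M^+)$ by $\Omega^+=\{|s_0^+\rangle,|s_1^+\rangle\}$ with $$|s_0^+\rangle=\sqrt{1-p}\,|0\rangle+\sqrt p\,|1\rangle,\qquad |s_1^+\rangle=\sqrt q\,|2\rangle+\sqrt{1-q}\,|1\rangle,$$ $\varepsilon_q^+(\overleftarrow x)=|s_i^+\rangle$ if and only if $\overleftarrow x\in s_i^+$, and $\mathcal M^+$ the measurement process described in the context. Then $\mathcal Q^+$ is an optimal quantum model for $\mathcal P_h^+$.
   Context: Heralding coin process $\mathcal P_h^+$: the stationary process over the alphabet $\{0,1,2\}$ generated by a two-state machine with states $s_0^+,s_1^+$: from $s_0^+$, emit $0$ and stay in $s_0^+$ with probability $1-p$, or emit $1$ and go to $s_1^+$ with probability $p$; from $s_1^+$, emit $1$ and stay in $s_1^+$ with probability $1-q$, or emit $2$ and go to $s_0^+$ with probability $q$. (Equivalently: take the stationary two-state Markov chain on $\{0,1\}$ flipping $0\to1$ with probability $p$ and $1\to0$ with probability $q$, and replace the first $0$ of each maximal run of $0$s by $2$.) Its causal states are $s_1^+=\{\overleftarrow x: x_{-1}=1\}$ and $s_0^+=\{\overleftarrow x:x_{-1}\neq1\}$, with probabilities $p/(p+q)$ and $q/(p+q)$. Here pasts are $\overleftarrow X=\dots X_{-2}X_{-1}$, futures $\overrightarrow X=X_0X_1\dots$; causal states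 are the classes of pasts $\overleftarrow x$ having the same conditional future distribution $P(\overrightarrow X|\overleftarrow X=\overleftarrow x)$. Quantum model of a process: a tuple $\mathcal Q=(f,\Omega,\mathcal M)$, where $\Omega$ is a set of pure states of a physical system $\Xi$, $f$ maps each past $\overleftarrow x$ to $f(\overleftarrow x)=|s_{\overleftarrow x}\rangle\in\Omega$, and $\mathcal M$ is a quantum measurement process (quantum instrument) on $\Xi$ such that for every past $\overleftarrow x$, applying $\mathcal M$ to $\Xi$ in state $f(\overleftarrow x)$ (i) yields output $x$ with probability $P(X_0=x|\overleftarrow X=\overleftarrow x)$ and (ii) then leaves $\Xi$ in state $f(\overleftarrow xx)$. Its entropy is $C_q(\mathcal Q)=S(\rho)=-\mathrm{Tr}(\rho\log\rho)$ with $\rho=\sum_{\overleftarrow x}P(\overleftarrow X=\overleftarrow x)|s_{\overleftarrow x}\rangle\langle s_{\overleftarrow x}|$. $\mathcal Q$ is optimal if $C_q(\mathcal Q')\ge C_q(\mathcal Q)$ for every other quantum model $\mathcal Q'$ of the same process. The process $\mathcal M^+$: $|0\rangle,|1\rangle,|2\rangle$ is an orthonormal basis. Let $V_p,V_q$ be unitaries with $V_p|0\rangle=|s_0^+\rangle$ and $V_qV_p|0\rangle=|s_1^+\rangle$. Given the memory (first system) in state $|s_i^+\rangle$, adjoin an ancilla (second system) in state $|0\rangle$, apply $V_p$ to the ancilla, then apply the controlled gate $C_{V_q}:|w\rangle|\psi\rangle\mapsto|w\rangle V_q^{(w\bmod 2)}|\psi\rangle$ with the first system as control; measure the first system in the basis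 $\{|0\rangle,|1\rangle,|2\rangle\}$, the result being the output $x_t$, and retain the second system as the new memory. *)

theory Defs
  imports "HOL-Probability.Probability"
begin

section \<open>Stationary processes, pasts and causal states\<close>

definition seq_space :: "'t set \<Rightarrow> ('t \<Rightarrow> 'a) measure" where
  "seq_space T = (\<Pi>\<^sub>M t\<in>T. count_space UNIV)"

definition stationary_process :: "(int \<Rightarrow> 'a) measure \<Rightarrow> bool" where
  "stationary_process M \<longleftrightarrow>
     prob_space M \<and> sets M = sets (seq_space UNIV) \<and>
     distr M (seq_space UNIV) (\<lambda>x t. x (t + 1)) = M"

definition cyl :: "int \<Rightarrow> 'a list \<Rightarrow> (int \<Rightarrow> 'a) set" where
  "cyl t w = {x. \<forall>k<length w. x (t + int k) = w ! k}"

text \<open>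
  A past \<open>\<dots> x\<^sub>-\<^sub>2 x\<^sub>-\<^sub>1\<close> is the function \<open>h\<close> with \<open>h k\<close> the symbol at time \<open>-1 - k\<close>.
  Hence \<open>past_snoc h x\<close>, the past \<open>h\<close> followed by the symbol \<open>x\<close>, puts \<open>x\<close> at index \<open>0\<close>.
\<close>

type_synonym 'a past = "nat \<Rightarrow> 'a"

definition past_of :: "(int \<Rightarrow> 'a) \<Rightarrow> 'a past" where
  "past_of x = (\<lambda>k. x (- 1 - int k))"

definition past_snoc :: "'a past \<Rightarrow> 'a \<Rightarrow> 'a past" where
  "past_snoc h x = case_nat x h"

definition past_law :: "(int \<Rightarrow> 'a) measure \<Rightarrow> 'a past measure" where
  "past_law M = distr M (seq_space UNIV) past_of"

definition past_window :: "'a past \<Rightarrow> nat \<Rightarrow> (int \<Rightarrow> 'a) set" where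
  "past_window h n = {x. \<forall>k<n. past_of x k = h k}"

text \<open>
  The pasts of the process are the sequences all of whose finite windows have positive
  probability.  At such a past the conditional probability of a future word is the limit of the
  elementary conditional probabilities given longer and longer windows; this fixes a version that is
  defined pointwise, although a single past usually has probability zero.
\<close>

definition pasts :: "(int \<Rightarrow> 'a) measure \<Rightarrow> 'a past set" where
  "pasts M = {h. \<forall>n. 0 < measure M (past_window h n)}"

definition cond_future :: "(int \<Rightarrow> 'a) measure \<Rightarrow> 'a past \<Rightarrow> 'a list \<Rightarrow> real" where
  "cond_future M h w =
     lim (\<lambda>n. measure M (past_window h n \<inter> cyl 0 w) / measure M (past_window h n))"

definition causal_equiv :: "(int \<Rightarrow> 'a) measure \<Rightarrow> ('a past \<times> 'a past) set" where
  "causal_equiv M =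
     {(h, h'). h \<in> pasts M \<and> h' \<in> pasts M \<and> (\<forall>w. cond_future M h w = cond_future M h' w)}"

definition causal_states :: "(int \<Rightarrow> 'a) measure \<Rightarrow> 'a past set set" where
  "causal_states M = pasts M // causal_equiv M"


section \<open>Processes generated by a finite-state machine\<close>

text \<open>
  \<open>T s x s'\<close> is the probability that the machine in state \<open>s\<close> emits \<open>x\<close> and goes to \<open>s'\<close>.
\<close>

type_synonym ('s, 'a) machine = "'s \<Rightarrow> 'a \<Rightarrow> 's \<Rightarrow> real"

primrec emit_prob :: "('s::finite, 'a) machine \<Rightarrow> 's \<Rightarrow> 'a list \<Rightarrow> real" where
  "emit_prob T s [] = 1"
| "emit_prob T s (x # w) = (\<Sum>s'\<in>UNIV. T s x s' * emit_prob T s' w)"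

definition stationary_dist :: "('s::finite, 'a::finite) machine \<Rightarrow> ('s \<Rightarrow> real) \<Rightarrow> bool" where
  "stationary_dist T \<pi> \<longleftrightarrow>
     (\<forall>s. 0 \<le> \<pi> s) \<and> (\<Sum>s\<in>UNIV. \<pi> s) = 1 \<and>
     (\<forall>s'. \<pi> s' = (\<Sum>s\<in>UNIV. \<Sum>x\<in>UNIV. \<pi> s * T s x s'))"

definition stationary_process_of ::
    "('s::finite, 'a::finite) machine \<Rightarrow> (int \<Rightarrow> 'a) measure \<Rightarrow> bool" where
  "stationary_process_of T M \<longleftrightarrow>
     stationary_process M \<and>
     (\<exists>\<pi>. stationary_dist T \<pi> \<and>
        (\<forall>t w. measure M (cyl t w) = (\<Sum>s\<in>UNIV. \<pi> s * emit_prob T s w)))"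


section \<open>Operators on a separable Hilbert space\<close>

text \<open>
  Up to isomorphism a separable complex Hilbert space is the space of square-summable families over
  a countable index type \<open>'i\<close> (finite in the finite-dimensional case).  Vectors and operators
  are given by their coordinates and matrix entries in the standard basis.
\<close>

type_synonym 'i vec = "'i \<Rightarrow> complex"
type_synonym 'i op = "'i \<Rightarrow> 'i \<Rightarrow> complex"

definition ket :: "'i \<Rightarrow> 'i vec" where
  "ket i = (\<lambda>j. if j = i then 1 else 0)"

definition unit_vector :: "'i vec \<Rightarrow> bool" where
  "unit_vector \<psi> \<longleftrightarrow> ((\<lambda>i. (cmod (\<psi> i))\<^sup>2) has_sum 1) UNIV"

definition ketbra :: "'i vec \<Rightarrow> 'i vec \<Rightarrow> 'i op" where
  "ketbra \<psi> \<phi> = (\<lambda>i j. \<psi> i * cnj (\<phi> j))"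

definition tr :: "'i op \<Rightarrow> complex" where
  "tr A = (\<Sum>\<^sub>\<infinity>i. A i i)"

definition pos_semidef :: "'i op \<Rightarrow> bool" where
  "pos_semidef A \<longleftrightarrow>
     (\<forall>F c. finite F \<longrightarrow> (\<Sum>i\<in>F. \<Sum>j\<in>F. cnj (c i) * A i j * c j) \<in> \<real>\<^sub>\<ge>\<^sub>0)"

definition pos_trace_class :: "'i op \<Rightarrow> bool" where
  "pos_trace_class A \<longleftrightarrow> pos_semidef A \<and> (\<lambda>i. A i i) summable_on UNIV"

text \<open>
  Every positive semidefinite matrix with summable diagonal is the matrix of a positive trace-class
  operator, and the trace-class operators are the complex linear span of the positive ones.
\<close>

definition trace_class :: "'i op set" where
  "trace_class = {(\<lambda>i j. A i j - B i j + \<i> * (C i j - D i j)) | A B C D.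
     pos_trace_class A \<and> pos_trace_class B \<and> pos_trace_class C \<and> pos_trace_class D}"

definition orthonormal :: "('k \<Rightarrow> 'i vec) \<Rightarrow> bool" where
  "orthonormal e \<longleftrightarrow>
     (\<forall>k l. ((\<lambda>i. cnj (e k i) * e l i) has_sum (if k = l then 1 else 0)) UNIV)"

definition spectral_decomposition :: "'i op \<Rightarrow> ('i \<Rightarrow> real) \<Rightarrow> ('i \<Rightarrow> 'i vec) \<Rightarrow> bool" where
  "spectral_decomposition \<rho> lam e \<longleftrightarrow>
     (\<forall>k. 0 \<le> lam k) \<and> orthonormal e \<and>
     (\<forall>i j. ((\<lambda>k. complex_of_real (lam k) * ketbra (e k) (e k) i j) has_sum \<rho> i j) UNIV)"

text \<open>
  \<open>- Tr (\<rho> log \<rho>)\<close>, evaluated on the eigenvectors of the density operator \<open>\<rho>\<close>, with values in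
  \<open>[0, \<infinity>]\<close>.  A density operator has a spectral decomposition, and all of them have the same
  non-zero eigenvalues with multiplicity; so the set below has exactly one element, and \<open>Inf\<close> only
  extracts it.  The eigenvalues lie in \<open>[0, 1]\<close>, so \<open>ennreal\<close> truncates nothing, and
  \<open>0 * log 2 0 = 0\<close> as required.
\<close>

definition von_neumann_entropy :: "'i op \<Rightarrow> ennreal" where
  "von_neumann_entropy \<rho> =
     Inf {(\<Sum>\<^sub>\<infinity>k. ennreal (- (lam k * log 2 (lam k)))) | lam e. spectral_decomposition \<rho> lam e}"


section \<open>Quantum instruments and quantum models\<close>

text \<open>
  Only the values on trace-class operators matter.  The ampliation of \<open>E\<close> acts on operators on
  \<open>\<complex>\<^sup>n \<otimes> \<ell>\<^sup>2('i)\<close>, represented as those block matrices over \<open>nat \<times> 'i\<close> which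
  vanish outside the first \<open>n\<close> rows and columns of blocks.
\<close>

definition trace_class_linear :: "('i op \<Rightarrow> 'i op) \<Rightarrow> bool" where
  "trace_class_linear E \<longleftrightarrow>
     (\<forall>A\<in>trace_class. E A \<in> trace_class) \<and>
     (\<forall>A\<in>trace_class. \<forall>B\<in>trace_class. E (\<lambda>i j. A i j + B i j) = (\<lambda>i j. E A i j + E B i j)) \<and>
     (\<forall>c. \<forall>A\<in>trace_class. E (\<lambda>i j. c * A i j) = (\<lambda>i j. c * E A i j))"

definition ampliation :: "('i op \<Rightarrow> 'i op) \<Rightarrow> (nat \<times> 'i) op \<Rightarrow> (nat \<times> 'i) op" where
  "ampliation E A = (\<lambda>(a, i) (b, j). E (\<lambda>i' j'. A (a, i') (b, j')) i j)"

definition completely_positive :: "('i op \<Rightarrow> 'i op) \<Rightarrow> bool" where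
  "completely_positive E \<longleftrightarrow>
     (\<forall>n A. pos_trace_class A \<and> (\<forall>a b i j. n \<le> a \<or> n \<le> b \<longrightarrow> A (a, i) (b, j) = 0)
        \<longrightarrow> pos_semidef (ampliation E A))"

definition quantum_instrument :: "('a::finite \<Rightarrow> 'i op \<Rightarrow> 'i op) \<Rightarrow> bool" where
  "quantum_instrument E \<longleftrightarrow>
     (\<forall>x. trace_class_linear (E x) \<and> completely_positive (E x)) \<and>
     (\<forall>A\<in>trace_class. (\<Sum>x\<in>UNIV. tr (E x A)) = tr A)"

type_synonym ('a, 'i) qmodel =
  "('a past \<Rightarrow> 'i vec) \<times> 'i vec set \<times> ('a \<Rightarrow> 'i op \<Rightarrow> 'i op)"

text \<open>
  Pure states are unit vectors, compared through their projectors, that is, up to a phase.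
  Measurability of the encoding makes the average state over the pasts meaningful.
\<close>

definition quantum_model ::
    "(int \<Rightarrow> 'a::finite) measure \<Rightarrow> ('a, 'i::countable) qmodel \<Rightarrow> bool" where
  "quantum_model M Q \<longleftrightarrow> (case Q of (f, \<Omega>, E) \<Rightarrow>
     (\<forall>\<psi>\<in>\<Omega>. unit_vector \<psi>) \<and>
     (\<forall>h\<in>pasts M. f h \<in> \<Omega>) \<and>
     (\<forall>i. set_borel_measurable (past_law M) (pasts M) (\<lambda>h. f h i)) \<and>
     quantum_instrument E \<and>
     (\<forall>h\<in>pasts M. \<forall>x.
        tr (E x (ketbra (f h) (f h))) = complex_of_real (cond_future M h [x]) \<and>
        (0 < cond_future M h [x] \<longrightarrow>
           (\<lambda>i j. E x (ketbra (f h) (f h)) i j / tr (E x (ketbra (f h) (f h)))) =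
           ketbra (f (past_snoc h x)) (f (past_snoc h x)))))"

definition memory_state :: "(int \<Rightarrow> 'a) measure \<Rightarrow> ('a past \<Rightarrow> 'i vec) \<Rightarrow> 'i op" where
  "memory_state M f = (\<lambda>i j. LINT h:pasts M|past_law M. ketbra (f h) (f h) i j)"

definition C_q :: "(int \<Rightarrow> 'a) measure \<Rightarrow> ('a, 'i) qmodel \<Rightarrow> ennreal" where
  "C_q M Q = von_neumann_entropy (memory_state M (fst Q))"

text \<open>
  The type argument is the index type of the state space of the competing models; a statement for
  all types \<open>'j\<close> quantifies over all separable Hilbert spaces.
\<close>

definition optimal_quantum_model ::
    "'j::countable itself \<Rightarrow> (int \<Rightarrow> 'a::finite) measure \<Rightarrow> ('a, 'i::countable) qmodel \<Rightarrow> bool" where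
  "optimal_quantum_model (_ :: 'j itself) M Q \<longleftrightarrow>
     quantum_model M Q \<and>
     (\<forall>Q' :: ('a, 'j) qmodel. quantum_model M Q' \<longrightarrow> C_q M Q \<le> C_q M Q')"


section \<open>Circuits on finite-dimensional systems\<close>

definition op_id :: "'i op" where
  "op_id = (\<lambda>i j. if i = j then 1 else 0)"

definition op_mult :: "'i::finite op \<Rightarrow> 'i op \<Rightarrow> 'i op" where
  "op_mult A B = (\<lambda>i j. \<Sum>k\<in>UNIV. A i k * B k j)"

definition op_pow :: "'i::finite op \<Rightarrow> nat \<Rightarrow> 'i op" where
  "op_pow A n = (op_mult A ^^ n) op_id"

definition op_apply :: "'i::finite op \<Rightarrow> 'i vec \<Rightarrow> 'i vec" where
  "op_apply A \<psi> = (\<lambda>i. \<Sum>k\<in>UNIV. A i k * \<psi> k)"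

definition adj :: "'i op \<Rightarrow> 'i op" where
  "adj A = (\<lambda>i j. cnj (A j i))"

definition unitary :: "'i::finite op \<Rightarrow> bool" where
  "unitary V \<longleftrightarrow> op_mult (adj V) V = op_id \<and> op_mult V (adj V) = op_id"

definition conjugate_by :: "'i::finite op \<Rightarrow> 'i op \<Rightarrow> 'i op" where
  "conjugate_by A \<rho> = op_mult (op_mult A \<rho>) (adj A)"

definition tensor :: "'i op \<Rightarrow> 'j op \<Rightarrow> ('i \<times> 'j) op" where
  "tensor A B = (\<lambda>(i, a) (j, b). A i j * B a b)"

definition partial_trace_fst :: "('i::finite \<times> 'j) op \<Rightarrow> 'j op" where
  "partial_trace_fst A = (\<lambda>a b. \<Sum>i\<in>UNIV. A (i, a) (i, b))"


section \<open>The heralding coin\<close>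

datatype trit = T0 | T1 | T2

lemma UNIV_trit: "(UNIV :: trit set) = {T0, T1, T2}"
  by (auto intro: trit.exhaust)

instance trit :: finite
  by standard (simp add: UNIV_trit)

datatype coin_state = S0 | S1

lemma UNIV_coin_state: "(UNIV :: coin_state set) = {S0, S1}"
  by (auto intro: coin_state.exhaust)

instance coin_state :: finite
  by standard (simp add: UNIV_coin_state)

fun trit_val :: "trit \<Rightarrow> nat" where
  "trit_val T0 = 0"
| "trit_val T1 = 1"
| "trit_val T2 = 2"

fun heralding_machine :: "real \<Rightarrow> real \<Rightarrow> (coin_state, trit) machine" where
  "heralding_machine p q S0 T0 S0 = 1 - p"
| "heralding_machine p q S0 T1 S1 = p"
| "heralding_machine p q S1 T1 S1 = 1 - q"
| "heralding_machine p q S1 T2 S0 = q"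
| "heralding_machine p q _ _ _ = 0"

definition heralding_process :: "real \<Rightarrow> real \<Rightarrow> (int \<Rightarrow> trit) measure \<Rightarrow> bool" where
  "heralding_process p q M \<longleftrightarrow> stationary_process_of (heralding_machine p q) M"

definition s0_plus :: "(int \<Rightarrow> trit) measure \<Rightarrow> trit past set" where
  "s0_plus M = {h \<in> pasts M. h 0 \<noteq> T1}"

definition s1_plus :: "(int \<Rightarrow> trit) measure \<Rightarrow> trit past set" where
  "s1_plus M = {h \<in> pasts M. h 0 = T1}"

definition ket_s0 :: "real \<Rightarrow> trit vec" where
  "ket_s0 p = (\<lambda>i. complex_of_real (sqrt (1 - p)) * ket T0 i + complex_of_real (sqrt p) * ket T1 i)"

definition ket_s1 :: "real \<Rightarrow> trit vec" where
  "ket_s1 q = (\<lambda>i. complex_of_real (sqrt q) * ket T2 i + complex_of_real (sqrt (1 - q)) * ket T1 i)"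

definition \<epsilon>_plus :: "real \<Rightarrow> real \<Rightarrow> (int \<Rightarrow> trit) measure \<Rightarrow> trit past \<Rightarrow> trit vec" where
  "\<epsilon>_plus p q M h = (if h \<in> s1_plus M then ket_s1 q else ket_s0 p)"

definition \<Omega>_plus :: "real \<Rightarrow> real \<Rightarrow> trit vec set" where
  "\<Omega>_plus p q = {ket_s0 p, ket_s1 q}"

definition controlled_mod2 :: "trit op \<Rightarrow> (trit \<times> trit) op" where
  "controlled_mod2 V =
     (\<lambda>(w, a) (w', b). if w = w' then op_pow V (trit_val w mod 2) a b else 0)"

definition M_plus :: "trit op \<Rightarrow> trit op \<Rightarrow> trit \<Rightarrow> trit op \<Rightarrow> trit op" where
  "M_plus Vp Vq x \<rho> =
     (let \<rho>1 = tensor \<rho> (ketbra (ket T0) (ket T0));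
          \<rho>2 = conjugate_by (tensor op_id Vp) \<rho>1;
          \<rho>3 = conjugate_by (controlled_mod2 Vq) \<rho>2;
          \<rho>4 = conjugate_by (tensor (ketbra (ket x) (ket x)) op_id) \<rho>3
      in partial_trace_fst \<rho>4)"

definition Q_plus ::
    "real \<Rightarrow> real \<Rightarrow> (int \<Rightarrow> trit) measure \<Rightarrow> trit op \<Rightarrow> trit op \<Rightarrow> (trit, trit) qmodel" where
  "Q_plus p q M Vp Vq = (\<epsilon>_plus p q M, \<Omega>_plus p q, M_plus Vp Vq)"

subsection \<open>The causal states\<close>

fun st :: "trit \<Rightarrow> coin_state" where
  "st T1 = S1"
| "st _ = S0"

lemma emit_Cons:
  "emit_prob (heralding_machine p q) s (x # w) =
     heralding_machine p q s x (st x) * emit_prob (heralding_machine p q) (st x) w"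
  by (cases s; cases x) (simp_all add: UNIV_coin_state)

lemma emit_append:
  "u \<noteq> [] \<Longrightarrow> emit_prob (heralding_machine p q) s (u @ w) =
     emit_prob (heralding_machine p q) s u * emit_prob (heralding_machine p q) (st (last u)) w"
proof (induction u arbitrary: s)
  case Nil
  then show ?case by simp
next
  case (Cons x u)
  show ?case
  proof (cases "u = []")
    case True
    then show ?thesis
      by (simp only: append.simps last.simps emit_Cons simp_thms if_True emit_prob.simps(1)
          mult_1_right)
  next
    case False
    then show ?thesis using Cons.IH[OF False, of "st x"]
      by (simp only: append_Cons emit_Cons last_ConsR) (simp add: mult.assoc)
  qed
qed

definition window_word :: "'a past \<Rightarrow> nat \<Rightarrow> 'a list" where
  "window_word h n = rev (map h [0..<n])"

lemma past_window_cyl: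
  "past_window h n \<inter> cyl 0 w = cyl (- int n) (window_word h n @ w)" (is "?L = ?R")
proof (intro set_eqI iffI)
  fix x assume x: "x \<in> ?L"
  show "x \<in> ?R"
    unfolding cyl_def mem_Collect_eq
  proof (intro allI impI)
    fix k assume k: "k < length (window_word h n @ w)"
    show "x (- int n + int k) = (window_word h n @ w) ! k"
    proof (cases "k < n")
      case True
      have "past_of x (n - Suc k) = h (n - Suc k)"
        using x True by (auto simp: past_window_def)
      moreover have "- 1 - int (n - Suc k) = - int n + int k" using True by linarith
      ultimately show ?thesis using True
        by (simp add: past_of_def window_word_def nth_append rev_nth)
    next
      case False
      have "\<forall>j<length w. x (0 + int j) = w ! j" using x by (simp add: cyl_def)
      moreover have "k - n < length w" using k False by (simp add: window_word_def)
      ultimately have "x (0 + int (k - n)) = w ! (k - n)" by blast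
      moreover have "0 + int (k - n) = - int n + int k" using False by linarith
      ultimately have "x (- int n + int k) = w ! (k - n)" by metis
      then show ?thesis using False by (simp add: window_word_def nth_append)
    qed
  qed
next
  fix x assume "x \<in> ?R"
  then have x: "\<And>k. k < n + length w \<Longrightarrow> x (- int n + int k) = (window_word h n @ w) ! k"
    by (simp add: cyl_def window_word_def)
  have "past_of x k = h k" if "k < n" for k
  proof -
    have "- int n + int (n - Suc k) = - 1 - int k" using that by linarith
    then show ?thesis using x[of "n - Suc k"] that
      by (simp add: past_of_def window_word_def nth_append rev_nth)
  qed
  moreover have "x (0 + int k) = w ! k" if "k < length w" for k
    using x[of "n + k"] that by (simp add: window_word_def nth_append)
  ultimately show "x \<in> ?L" by (simp add: past_window_def cyl_def)
qed

lemma past_window_eq: "past_window h n = cyl (- int n) (window_word h n)"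
  using past_window_cyl[of h n "[]"] by (simp add: cyl_def)

lemma cond_future_heralding:
  assumes "heralding_process p q M" and h: "h \<in> pasts M"
  shows "cond_future M h w = emit_prob (heralding_machine p q) (st (h 0)) w"
proof -
  let ?e = "emit_prob (heralding_machine p q)"
  obtain \<pi> where \<pi>: "\<And>t w. measure M (cyl t w) = (\<Sum>s\<in>UNIV. \<pi> s * ?e s w)"
    using assms(1) unfolding heralding_process_def stationary_process_of_def by blast
  have "measure M (past_window h n \<inter> cyl 0 w) / measure M (past_window h n) = ?e (st (h 0)) w"
    if "n \<ge> 1" for n
  proof -
    have ne: "window_word h n \<noteq> []" and last: "last (window_word h n) = h 0"
      using that by (auto simp: window_word_def last_rev hd_map)
    have "measure M (past_window h n \<inter> cyl 0 w) =
        (\<Sum>s\<in>UNIV. \<pi> s * ?e s (window_word h n)) * ?e (st (h 0)) w"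
      unfolding past_window_cyl \<pi> emit_append[OF ne] last
      by (simp add: sum_distrib_right mult.assoc)
    then have "measure M (past_window h n \<inter> cyl 0 w) =
        measure M (past_window h n) * ?e (st (h 0)) w"
      by (simp only: past_window_eq \<pi> flip: past_window_cyl)
    moreover have "measure M (past_window h n) > 0" using h by (simp add: pasts_def)
    ultimately show ?thesis by simp
  qed
  then have "(\<lambda>n. measure M (past_window h n \<inter> cyl 0 w) / measure M (past_window h n))
      \<longlonglongrightarrow> ?e (st (h 0)) w"
    by (intro tendsto_eventually) (auto simp: eventually_sequentially)
  then show ?thesis unfolding cond_future_def by (rule limI)
qed

lemma stationary_dist_heralding:
  assumes "stationary_dist (heralding_machine p q) \<pi>" "p + q > 0"
  shows "\<pi> S0 = q / (p + q)" "\<pi> S1 = p / (p + q)"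
proof -
  have "(\<Sum>s\<in>UNIV. \<pi> s) = 1"
    using assms(1) unfolding stationary_dist_def by blast
  then have 1: "\<pi> S0 + \<pi> S1 = 1" by (simp add: UNIV_coin_state)
  have "\<pi> S1 = (\<Sum>s\<in>UNIV. \<Sum>x\<in>UNIV. \<pi> s * heralding_machine p q s x S1)"
    using assms(1) unfolding stationary_dist_def by blast
  also have "\<dots> = \<pi> S0 * p + \<pi> S1 * (1 - q)"
    by (simp add: UNIV_coin_state UNIV_trit)
  finally have 2: "\<pi> S1 = \<pi> S0 * p + \<pi> S1 * (1 - q)" .
  have 3: "\<pi> S0 = 1 - \<pi> S1" using 1 by simp
  have "\<pi> S1 * (p + q) = p" using 2 unfolding 3 by algebra
  then show S1: "\<pi> S1 = p / (p + q)" using assms(2) by (simp add: eq_divide_eq)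
  show "\<pi> S0 = q / (p + q)" unfolding 3 S1 using assms(2) by (simp add: field_simps)
qed

lemma emit_nonneg:
  assumes "0 \<le> p" "p \<le> 1" "0 \<le> q" "q \<le> 1"
  shows "0 \<le> emit_prob (heralding_machine p q) s w"
proof (induction w arbitrary: s)
  case Nil
  then show ?case by simp
next
  case (Cons x w)
  have "0 \<le> heralding_machine p q s x (st x)"
    using assms by (cases s; cases x) simp_all
  then show ?case unfolding emit_Cons using Cons.IH by simp
qed

lemma alternating_past:
  assumes pq: "0 < p" "p \<le> 1" "0 < q" "q \<le> 1" and proc: "heralding_process p q M"
    and h: "\<And>k. h k \<noteq> T0" "\<And>k. h (Suc k) = T1 \<longleftrightarrow> h k = T2"
  shows "h \<in> pasts M"
proof -
  let ?T = "heralding_machine p q"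
  let ?f = "\<lambda>x. if x = T1 then S0 else S1"
  obtain \<pi> where \<pi>: "\<And>t w. measure M (cyl t w) = (\<Sum>s\<in>UNIV. \<pi> s * emit_prob ?T s w)"
      and sd: "stationary_dist ?T \<pi>"
    using proc unfolding heralding_process_def stationary_process_of_def by blast
  have \<pi>_pos: "\<pi> s > 0" for s
    using stationary_dist_heralding[OF sd] pq by (cases s) auto
  have step: "?T (?f (h k)) (h k) (st (h k)) > 0" for k
    using h(1)[of k] pq by (cases "h k") auto
  have ww: "window_word h (Suc n) = h n # window_word h n" for n
    by (simp add: window_word_def)
  have emit: "emit_prob ?T (?f (h n)) (window_word h (Suc n)) > 0" for n
  proof (induction n)
    case 0
    show ?case unfolding ww emit_Cons using step[of 0] by (simp add: window_word_def)
  next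
    case (Suc n)
    have "st (h (Suc n)) = ?f (h n)"
      using h(1)[of n] h(1)[of "Suc n"] h(2)[of n] by (cases "h n"; cases "h (Suc n)") auto
    then show ?case unfolding ww[of "Suc n"] emit_Cons
      using mult_pos_pos[OF step[of "Suc n"] Suc.IH] by simp
  qed
  have ex: "\<exists>s. emit_prob ?T s (window_word h n) > 0" for n
    using emit by (cases n) (auto simp: window_word_def)
  have "\<And>n. measure M (past_window h n) > 0"
    unfolding past_window_eq \<pi>
  proof -
    fix n
    obtain s where "emit_prob ?T s (window_word h n) > 0" using ex[of n] by blast
    then have "0 < \<pi> s * emit_prob ?T s (window_word h n)" using \<pi>_pos[of s] by simp
    also have "\<dots> \<le> (\<Sum>s\<in>UNIV. \<pi> s * emit_prob ?T s (window_word h n))"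
      using \<pi>_pos emit_nonneg[of p q] pq
      by (intro member_le_sum) (auto intro!: mult_nonneg_nonneg simp: less_imp_le)
    finally show "0 < (\<Sum>s\<in>UNIV. \<pi> s * emit_prob ?T s (window_word h n))" .
  qed
  then show ?thesis by (simp add: pasts_def)
qed

theorem causal_states_heralding:
  assumes pq: "0 < p" "p \<le> 1" "0 < q" "q \<le> 1" and proc: "heralding_process p q M"
  shows "causal_states M = {s0_plus M, s1_plus M}"
proof -
  let ?h0 = "\<lambda>k::nat. if even k then T2 else T1"
  let ?h1 = "\<lambda>k::nat. if even k then T1 else T2"
  have ne: "?h0 \<in> pasts M" "?h1 \<in> pasts M"
    by (rule alternating_past[OF pq proc]; simp)+
  have "emit_prob (heralding_machine p q) S0 [T2] \<noteq> emit_prob (heralding_machine p q) S1 [T2]"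
    using pq by (simp add: UNIV_coin_state)
  then have "(\<forall>w. cond_future M h w = cond_future M h' w) \<longleftrightarrow> (h 0 = T1 \<longleftrightarrow> h' 0 = T1)"
    if "h \<in> pasts M" "h' \<in> pasts M" for h h'
    unfolding cond_future_heralding[OF proc that(1)] cond_future_heralding[OF proc that(2)]
    by (cases "h 0"; cases "h' 0") (simp_all del: emit_prob.simps, metis+)
  then have cls: "causal_equiv M `` {h} = (if h 0 = T1 then s1_plus M else s0_plus M)"
    if "h \<in> pasts M" for h
    using that unfolding causal_equiv_def s0_plus_def s1_plus_def by auto
  have "causal_states M = (\<lambda>h. causal_equiv M `` {h}) ` pasts M"
    unfolding causal_states_def quotient_def by auto
  also have "\<dots> = (\<lambda>h. if h 0 = T1 then s1_plus M else s0_plus M) ` pasts M"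
    using cls by (intro image_cong) auto
  also have "\<dots> = {s0_plus M, s1_plus M}"
  proof -
    have "s0_plus M \<in> (\<lambda>h. if h 0 = T1 then s1_plus M else s0_plus M) ` pasts M"
      by (rule image_eqI[OF _ ne(1)]) simp
    moreover have "s1_plus M \<in> (\<lambda>h. if h 0 = T1 then s1_plus M else s0_plus M) ` pasts M"
      by (rule image_eqI[OF _ ne(2)]) simp
    ultimately show ?thesis by auto
  qed
  finally show ?thesis .
qed

end

theory Submission
  imports Defs
begin

text \<open>
  Let \<open>\<pi>\<^sub>0, \<pi>\<^sub>1\<close> be the weights of the causal states and \<open>c = sqrt (p (1 - q))\<close> the overlap of
  \<open>|s\<^sub>0\<^sup>+\<rangle>\<close> and \<open>|s\<^sub>1\<^sup>+\<rangle>\<close>.  From \<open>s\<^sub>0\<^sup>+\<close> and \<open>s\<^sub>1\<^sup>+\<close> only the output \<open>1\<close> is possible in both cases, with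
  probabilities \<open>p\<close> and \<open>1 - q\<close>; as instruments do not decrease fidelity, in every model the states of
  two pasts from different causal states have overlap at most \<open>c\<close>.  No operator convexity is needed to
  turn this into an entropy bound.  For a unit vector \<open>v\<close> the operator
  \<open>\<pi>\<^sub>0 |\<psi>\<rangle>\<langle>\<psi>| + \<pi>\<^sub>1 |\<phi>\<rangle>\<langle>\<phi>|\<close> has expectation in \<open>v\<close> at most the larger root \<open>m\<close> of
  \<open>m (1 - m) = \<pi>\<^sub>0 \<pi>\<^sub>1 (1 - c\<^sup>2)\<close>; averaging over pairs of pasts shows that all eigenvalues of the memory
  state are at most \<open>m\<close>.  Such a spectrum is majorized by \<open>(m, 1 - m)\<close>, which is the spectrum of the
  memory state of \<open>\<Q>\<^sup>+\<close>.
\<close>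


section \<open>Entropy of a bounded probability vector\<close>

text \<open>Rewrites nonnegative sums as integrals over a counting measure, so that Tonelli's
  theorem can exchange them with other sums and with integrals over pasts.\<close>

lemma has_sum_nonneg_iff_nn_integral:
  fixes f :: "'i \<Rightarrow> real"
  assumes f: "\<And>i. 0 \<le> f i" and s: "0 \<le> s"
  shows "(f has_sum s) UNIV \<longleftrightarrow> (\<integral>\<^sup>+i. ennreal (f i) \<partial>count_space UNIV) = ennreal s"
proof
  assume hs: "(f has_sum s) UNIV"
  then have "f summable_on UNIV" by (rule has_sum_imp_summable)
  then have abs: "Infinite_Set_Sum.abs_summable_on f UNIV"
    using f by (simp flip: abs_summable_equivalent)
  then have "integral\<^sup>L (count_space UNIV) f = s"
    using infsetsum_infsum[OF abs] infsumI[OF hs] by (simp add: infsetsum_def)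
  moreover have "integrable (count_space UNIV) f"
    using abs by (simp add: abs_summable_on_def)
  ultimately show "(\<integral>\<^sup>+i. ennreal (f i) \<partial>count_space UNIV) = ennreal s"
    using f by (simp add: nn_integral_eq_integral)
next
  assume eq: "(\<integral>\<^sup>+i. ennreal (f i) \<partial>count_space UNIV) = ennreal s"
  have int: "integrable (count_space UNIV) f"
    by (rule integrableI_nonneg) (use f eq in auto)
  then have abs: "Infinite_Set_Sum.abs_summable_on f UNIV"
    by (simp add: abs_summable_on_def)
  have "ennreal (integral\<^sup>L (count_space UNIV) f) = ennreal s"
    using nn_integral_eq_integral[OF int] f eq by simp
  then have "integral\<^sup>L (count_space UNIV) f = s"
    using f s by (simp add: integral_nonneg)
  then have "infsum f UNIV = s"
    using infsetsum_infsum[OF abs] by (simp add: infsetsum_def)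
  moreover have "f summable_on UNIV"
    using abs f by (simp flip: abs_summable_equivalent)
  ultimately show "(f has_sum s) UNIV" by (simp add: has_sum_iff)
qed

text \<open>The entropy of a competing model may be infinite. A summable real minorant of its terms
  still bounds it from below, because the finite partial sums of the minorant do.\<close>

lemma ennreal_le_infsum:
  fixes g t :: "'i \<Rightarrow> real"
  assumes g: "(g has_sum s) UNIV" and le: "\<And>i. 0 \<le> g i" "\<And>i. g i \<le> t i"
  shows "ennreal s \<le> (\<Sum>\<^sub>\<infinity>i. ennreal (t i))"
proof (cases "(\<Sum>\<^sub>\<infinity>i. ennreal (t i))")
  case (real r)
  have "sum g F \<le> r" if "finite F" for F
  proof -
    have "ennreal (sum g F) = (\<Sum>i\<in>F. ennreal (g i))"
      using le(1) by (simp add: sum_ennreal)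
    also have "\<dots> \<le> (\<Sum>i\<in>F. ennreal (t i))"
      using le by (intro sum_mono ennreal_leI)
    also have "\<dots> = (\<Sum>\<^sub>\<infinity>i\<in>F. ennreal (t i))" using that by simp
    also have "\<dots> \<le> (\<Sum>\<^sub>\<infinity>i. ennreal (t i))"
      by (rule infsum_mono_neutral) (auto intro: nonneg_summable_on_complete)
    finally show ?thesis using real by simp
  qed
  then have "s \<le> r" using g has_sum_le_finite_sums by blast
  then show ?thesis using real by (simp add: ennreal_leI)
qed simp

definition binary_entropy :: "real \<Rightarrow> real" where
  "binary_entropy x = - (x * log 2 x) - (1 - x) * log 2 (1 - x)"

lemma binary_entropy_flip: "binary_entropy (1 - x) = binary_entropy x"
  by (simp add: binary_entropy_def)

lemma binary_entropy_antimono: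
  assumes "1 / 2 \<le> x" "x \<le> y" "y < 1"
  shows "binary_entropy y \<le> binary_entropy x"
proof -
  let ?f = "\<lambda>x::real. - (x * ln x) - (1 - x) * ln (1 - x)"
  have "?f y \<le> ?f x"
  proof (rule DERIV_nonpos_imp_nonincreasing[OF assms(2)])
    fix z assume z: "x \<le> z" "z \<le> y"
    then have z': "1 / 2 \<le> z" "z < 1" using assms by auto
    \<comment> \<open>Entropy in nats: its derivative is nonpositive from 1/2 on.\<close>
    have "(?f has_real_derivative ln (1 - z) - ln z) (at z)"
      using z' by (auto intro!: derivative_eq_intros)
    moreover have "ln (1 - z) \<le> ln z" using z' by simp
    ultimately show "\<exists>d. (?f has_real_derivative d) (at z) \<and> d \<le> 0" by fastforce
  qed
  then have "?f y / ln 2 \<le> ?f x / ln 2" by (simp add: divide_right_mono)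
  moreover have "binary_entropy x = ?f x / ln 2" for x
    by (simp add: binary_entropy_def log_def diff_divide_distrib)
  ultimately show ?thesis by simp
qed

text \<open>A probability vector bounded by \<open>m \<ge> 1/2\<close> is majorized by \<open>(m, 1 - m)\<close>.\<close>

lemma binary_entropy_le_entropy:
  fixes lam :: "'i \<Rightarrow> real"
  assumes lam: "\<And>k. 0 \<le> lam k" "\<And>k. lam k \<le> m" "(lam has_sum 1) UNIV"
    and m: "1 / 2 \<le> m" "m < 1"
  shows "ennreal (binary_entropy m) \<le> (\<Sum>\<^sub>\<infinity>k. ennreal (- (lam k * log 2 (lam k))))"
proof (cases "\<forall>k. lam k \<le> 1 - m")
  case True
  \<comment> \<open>On [0, 1 - m] the function -x log x lies above the line of slope -log (1 - m),
    so the entropy is at least -log (1 - m). The binary entropy of \<open>m\<close> is a convex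
    combination of this number and the smaller -log m.\<close>
  let ?g = "\<lambda>k. lam k * - log 2 (1 - m)"
  have log_neg: "log 2 (1 - m) \<le> 0" "log 2 (1 - m) \<le> log 2 m" using m by auto
  have "(?g has_sum 1 * - log 2 (1 - m)) UNIV"
    by (intro has_sum_cmult_left lam)
  then have "ennreal (1 * - log 2 (1 - m)) \<le> (\<Sum>\<^sub>\<infinity>k. ennreal (- (lam k * log 2 (lam k))))"
  proof (rule ennreal_le_infsum)
    show "0 \<le> ?g k" for k using lam(1) log_neg by (intro mult_nonneg_nonneg) auto
    show "?g k \<le> - (lam k * log 2 (lam k))" for k
      using lam(1)[of k] True[rule_format, of k] m
      by (cases "lam k = 0") (auto intro!: mult_left_mono)
  qed
  moreover have "binary_entropy m \<le> 1 * - log 2 (1 - m)"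
  proof -
    have "m * log 2 (1 - m) \<le> m * log 2 m" using m log_neg by (intro mult_left_mono) auto
    then show ?thesis by (simp add: binary_entropy_def algebra_simps)
  qed
  ultimately show ?thesis by (meson ennreal_leI order_trans)
next
  case False
  then obtain k0 where k0: "1 - m < lam k0" by (auto simp: not_le)
  let ?x = "lam k0"
  have x: "0 < ?x" "?x < 1" "?x \<le> m" using k0 m lam(2)[of k0] by linarith+
  define L where "L = - log 2 (1 - ?x)"
  have L: "L \<ge> 0" using x by (simp add: L_def)
  \<comment> \<open>All other weights are at most \<open>1 - ?x\<close>, so slope \<open>L\<close>
    serves for them; the correction at \<open>k0\<close> restores the exact term. The total is the
    binary entropy of \<open>?x\<close>. As \<open>?x\<close> lies between \<open>1 - m\<close> and
    \<open>m\<close>, symmetry and monotonicity make it at least that of \<open>m\<close>.\<close>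
  let ?g = "\<lambda>k. lam k * L + (if k = k0 then - (?x * log 2 ?x) - ?x * L else 0)"
  have "((\<lambda>k. if k = k0 then - (?x * log 2 ?x) - ?x * L else 0) has_sum
      (- (?x * log 2 ?x) - ?x * L)) UNIV"
    by (rule has_sum_finite_neutralI[of "{k0}"]) auto
  then have "(?g has_sum 1 * L + (- (?x * log 2 ?x) - ?x * L)) UNIV"
    by (intro has_sum_add has_sum_cmult_left lam)
  then have "ennreal (1 * L + (- (?x * log 2 ?x) - ?x * L)) \<le>
      (\<Sum>\<^sub>\<infinity>k. ennreal (- (lam k * log 2 (lam k))))"
  proof (rule ennreal_le_infsum)
    show "0 \<le> ?g k" for k
      using lam(1)[of k] L x by (auto intro!: mult_nonneg_nonpos)
    show "?g k \<le> - (lam k * log 2 (lam k))" for k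
    proof (cases "k = k0 \<or> lam k = 0")
      case False
      have "sum lam {k, k0} \<le> 1"
        by (rule finite_sum_le_has_sum[OF lam(3)]) (use lam(1) in auto)
      then have "lam k \<le> 1 - ?x" using False by simp
      moreover have "0 < lam k" using lam(1)[of k] False by simp
      ultimately have "log 2 (lam k) \<le> log 2 (1 - ?x)" by simp
      then have "lam k * log 2 (lam k) \<le> lam k * log 2 (1 - ?x)"
        using lam(1) by (intro mult_left_mono)
      then show ?thesis using False by (simp add: L_def)
    qed auto
  qed
  moreover have "1 * L + (- (?x * log 2 ?x) - ?x * L) = binary_entropy ?x"
    by (simp add: binary_entropy_def L_def algebra_simps)
  moreover have "binary_entropy m \<le> binary_entropy ?x"
  proof (cases "1 / 2 \<le> ?x")
    case True
    then show ?thesis using binary_entropy_antimono x m by simp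
  next
    case False
    then have "binary_entropy m \<le> binary_entropy (1 - ?x)"
      using k0 m by (intro binary_entropy_antimono) auto
    then show ?thesis by (simp add: binary_entropy_flip)
  qed
  ultimately show ?thesis by (metis ennreal_leI order_trans)
qed

section \<open>Completely positive maps and overlaps\<close>

lemma unit_vector_summable: "unit_vector \<psi> \<Longrightarrow> (\<lambda>i. (cmod (\<psi> i))\<^sup>2) summable_on UNIV"
  unfolding unit_vector_def by (rule has_sum_imp_summable)

lemma ketbra_form:
  "(\<Sum>i\<in>F. \<Sum>j\<in>F. cnj (c i) * ketbra \<psi> \<psi> i j * c j) = of_real ((cmod (\<Sum>i\<in>F. cnj (c i) * \<psi> i))\<^sup>2)"
  unfolding complex_norm_square cnj_sum sum_product by (simp add: ketbra_def mult_ac)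

lemma pos_semidef_ketbra: "pos_semidef (ketbra \<psi> \<psi>)"
  unfolding pos_semidef_def ketbra_form by (simp only: nonneg_Reals_of_real_iff zero_le_power2) simp

lemma pos_trace_class_ketbra:
  assumes "(\<lambda>i. (cmod (\<psi> i))\<^sup>2) summable_on UNIV"
  shows "pos_trace_class (ketbra \<psi> \<psi>)"
proof -
  have "(\<lambda>i. complex_of_real ((cmod (\<psi> i))\<^sup>2)) summable_on UNIV"
    using assms by (rule summable_on_of_real)
  then have "(\<lambda>i. ketbra \<psi> \<psi> i i) summable_on UNIV"
    unfolding complex_norm_square by (simp add: ketbra_def)
  then show ?thesis
    by (simp add: pos_trace_class_def pos_semidef_ketbra)
qed

lemma square_summable_lincomb:
  fixes \<psi> \<phi> :: "'i vec"
  assumes "(\<lambda>i. (cmod (\<psi> i))\<^sup>2) summable_on UNIV" "(\<lambda>i. (cmod (\<phi> i))\<^sup>2) summable_on UNIV"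
  shows "(\<lambda>i. (cmod (a * \<psi> i + b * \<phi> i))\<^sup>2) summable_on UNIV"
proof (rule summable_on_comparison_test)
  show "(\<lambda>i. (2 * (cmod a)\<^sup>2) * (cmod (\<psi> i))\<^sup>2 + (2 * (cmod b)\<^sup>2) * (cmod (\<phi> i))\<^sup>2) summable_on UNIV"
    using assms by (intro summable_on_add summable_on_cmult_right)
  show "(cmod (a * \<psi> i + b * \<phi> i))\<^sup>2
      \<le> (2 * (cmod a)\<^sup>2) * (cmod (\<psi> i))\<^sup>2 + (2 * (cmod b)\<^sup>2) * (cmod (\<phi> i))\<^sup>2" for i
  proof -
    have "cmod (a * \<psi> i + b * \<phi> i) \<le> cmod a * cmod (\<psi> i) + cmod b * cmod (\<phi> i)"
      using norm_triangle_ineq[of "a * \<psi> i" "b * \<phi> i"] by (simp add: norm_mult)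
    then have "(cmod (a * \<psi> i + b * \<phi> i))\<^sup>2 \<le> (cmod a * cmod (\<psi> i) + cmod b * cmod (\<phi> i))\<^sup>2"
      by (intro power_mono) auto
    also have "\<dots> \<le> 2 * (cmod a * cmod (\<psi> i))\<^sup>2 + 2 * (cmod b * cmod (\<phi> i))\<^sup>2"
      by (smt (verit) sum_squares_bound power2_sum)
    finally show ?thesis by (simp add: power_mult_distrib)
  qed
qed auto

lemma summable_on_inner:
  fixes \<psi> \<phi> :: "'i vec"
  assumes "(\<lambda>i. (cmod (\<psi> i))\<^sup>2) summable_on UNIV" "(\<lambda>i. (cmod (\<phi> i))\<^sup>2) summable_on UNIV"
  shows "(\<lambda>i. \<psi> i * cnj (\<phi> i)) summable_on UNIV"
proof -
  have "(\<lambda>i. norm (\<psi> i * cnj (\<phi> i))) summable_on UNIV"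
  proof (rule summable_on_comparison_test)
    show "(\<lambda>i. (cmod (\<psi> i))\<^sup>2 + (cmod (\<phi> i))\<^sup>2) summable_on UNIV"
      using assms by (rule summable_on_add)
    show "norm (\<psi> i * cnj (\<phi> i)) \<le> (cmod (\<psi> i))\<^sup>2 + (cmod (\<phi> i))\<^sup>2" for i
    proof -
      have "0 \<le> cmod (\<psi> i) * cmod (\<phi> i)" by simp
      then have "cmod (\<psi> i) * cmod (\<phi> i) \<le> (cmod (\<psi> i))\<^sup>2 + (cmod (\<phi> i))\<^sup>2"
        using sum_squares_bound[of "cmod (\<psi> i)" "cmod (\<phi> i)"] by linarith
      then show ?thesis by (simp add: norm_mult)
    qed
  qed auto
  then show ?thesis by (rule abs_summable_summable)
qed

text \<open>Polarization with the vectors (\<psi> + z \<phi>) / 2 for z = 1, -1, i, -i; the halves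
  in \<open>?v\<close> supply the usual factor 1/4. Trace preservation can then be applied to
  off-diagonal operators.\<close>

lemma trace_class_ketbra:
  fixes \<psi> \<phi> :: "'i vec"
  assumes "(\<lambda>i. (cmod (\<psi> i))\<^sup>2) summable_on UNIV" "(\<lambda>i. (cmod (\<phi> i))\<^sup>2) summable_on UNIV"
  shows "ketbra \<psi> \<phi> \<in> trace_class"
proof -
  let ?v = "\<lambda>z i. (1 / 2) * \<psi> i + (z / 2) * \<phi> i"
  let ?P = "\<lambda>z. ketbra (?v z) (?v z)"
  have P: "pos_trace_class (?P z)" for z
    by (intro pos_trace_class_ketbra square_summable_lincomb assms)
  have "ketbra \<psi> \<phi> = (\<lambda>i j. ?P 1 i j - ?P (- 1) i j + \<i> * (?P \<i> i j - ?P (- \<i>) i j))"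
    by (intro ext) (simp add: ketbra_def field_simps)
  then show ?thesis unfolding trace_class_def using P by blast
qed

text \<open>As \<open>infsum\<close> is 0 on families that are not summable, this is what makes
  \<open>tr\<close> of a trace-class operator a genuine sum.\<close>

lemma trace_class_summable_diag:
  assumes "A \<in> trace_class"
  shows "(\<lambda>i. A i i) summable_on UNIV"
proof -
  obtain P Q R S where PQRS: "pos_trace_class P" "pos_trace_class Q" "pos_trace_class R"
      "pos_trace_class S" and A: "A = (\<lambda>i j. P i j - Q i j + \<i> * (R i j - S i j))"
    using assms unfolding trace_class_def by blast
  have "(\<lambda>i. P i i + (- Q i i) + \<i> * (R i i + (- S i i))) summable_on UNIV"
    using PQRS unfolding pos_trace_class_def
    by (intro summable_on_add summable_on_cmult_right) (auto simp: summable_on_uminus)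
  then show ?thesis by (simp add: A)
qed

text \<open>A positive 2 by 2 matrix has nonnegative determinant. Positivity of the form first
  forces Hermitian symmetry; the determinant is then read off a real quadratic in
  \<open>r\<close>.\<close>

lemma psd2_offdiag_bound:
  fixes u v b d :: complex
  assumes form: "\<And>c0 c1. cnj c0 * u * c0 + cnj c0 * b * c1 + cnj c1 * d * c0 + cnj c1 * v * c1 \<in> \<real>\<^sub>\<ge>\<^sub>0"
  shows "u \<in> \<real>\<^sub>\<ge>\<^sub>0" "v \<in> \<real>\<^sub>\<ge>\<^sub>0" "(cmod b)\<^sup>2 \<le> Re u * Re v"
proof -
  show u: "u \<in> \<real>\<^sub>\<ge>\<^sub>0" and v: "v \<in> \<real>\<^sub>\<ge>\<^sub>0"
    using form[of 1 0] form[of 0 1] by auto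
  \<comment> \<open>The form is real at (1, 1) and at (1, i), which fixes the imaginary and the real
    part of \<open>d\<close>.\<close>
  have d: "d = cnj b"
    using form[of 1 1] form[of 1 \<i>] u v by (auto simp: complex_eq_iff complex_nonneg_Reals_iff)
  define n where "n = (cmod b)\<^sup>2"
  have bb: "b * cnj b = of_real n" unfolding n_def by (rule complex_norm_square[symmetric])
  \<comment> \<open>The form at the vector (b r, -1); the factor \<open>b\<close> aligns the phases
    of the cross terms.\<close>
  have quad: "0 \<le> r\<^sup>2 * n * Re u - 2 * r * n + Re v" for r :: real
  proof -
    have "cnj (b * r) * u * (b * r) + cnj (b * r) * b * (- 1) + cnj (- 1) * d * (b * r)
        + cnj (- 1) * v * (- 1) = of_real (r\<^sup>2) * (b * cnj b) * u - of_real (2 * r) * (b * cnj b) + v"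
      unfolding d by (simp add: power2_eq_square algebra_simps)
    also have "\<dots> = of_real (r\<^sup>2 * n) * u - of_real (2 * r * n) + v"
      unfolding bb by simp
    finally have "of_real (r\<^sup>2 * n) * u - of_real (2 * r * n) + v \<in> \<real>\<^sub>\<ge>\<^sub>0"
      using form[of "b * r" "- 1"] by (simp only:)
    then show ?thesis
      by (simp add: complex_nonneg_Reals_iff)
  qed
  have u0: "0 \<le> Re u" and v0: "0 \<le> Re v" using u v by (auto simp: complex_nonneg_Reals_iff)
  show "(cmod b)\<^sup>2 \<le> Re u * Re v"
  proof (cases "Re u = 0 \<or> n = 0")
    case True
    have "n = 0"
    proof (rule ccontr)
      assume "n \<noteq> 0"
      \<comment> \<open>With \<open>Re u = 0\<close> the quadratic is affine in \<open>r\<close>,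
        and this \<open>r\<close> gives it the value -1.\<close>
      then show False using True quad[of "(Re v + 1) / (2 * n)"] by simp
    qed
    then show ?thesis using u0 v0 by (simp add: n_def)
  next
    case False
    \<comment> \<open>The choice \<open>r = 1 / Re u\<close> minimizes the quadratic.\<close>
    have "0 \<le> Re u * ((1 / Re u)\<^sup>2 * n * Re u - 2 * (1 / Re u) * n + Re v)"
      using u0 quad by (intro mult_nonneg_nonneg)
    also have "\<dots> = Re u * Re v - n" using False by (simp add: field_simps power2_eq_square)
    finally show ?thesis by (simp add: n_def)
  qed
qed

text \<open>Only \<open>2\<close>-positivity is used: the test operator is a multiple of the projection onto \<open>\<psi> \<oplus> \<phi>\<close>.\<close>

lemma completely_positive_ketbra_diag:
  fixes \<psi> \<phi> :: "'i vec"
  assumes cp: "completely_positive E"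
    and sq: "(\<lambda>i. (cmod (\<psi> i))\<^sup>2) summable_on UNIV" "(\<lambda>i. (cmod (\<phi> i))\<^sup>2) summable_on UNIV"
  shows "E (ketbra \<psi> \<psi>) i i \<in> \<real>\<^sub>\<ge>\<^sub>0" "E (ketbra \<phi> \<phi>) i i \<in> \<real>\<^sub>\<ge>\<^sub>0"
    and "(cmod (E (ketbra \<psi> \<phi>) i i))\<^sup>2 \<le> Re (E (ketbra \<psi> \<psi>) i i) * Re (E (ketbra \<phi> \<phi>) i i)"
proof -
  define \<xi> :: "(nat \<times> 'i) vec" where
    "\<xi> = (\<lambda>(a :: nat, i). if a = 0 then \<psi> i else if a = 1 then \<phi> i else 0)"
  have copy: "(\<lambda>(a, i). if a = a0 then g i else 0) summable_on UNIV"
    if "g summable_on UNIV" for a0 :: nat and g :: "'i \<Rightarrow> real"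
  proof -
    have "((\<lambda>(a, i). if a = a0 then g i else 0) \<circ> Pair a0) summable_on UNIV"
      using that by (simp add: o_def)
    then have "(\<lambda>(a, i). if a = a0 then g i else 0) summable_on range (Pair a0)"
      by (subst summable_on_reindex) (auto simp: inj_on_def)
    then show ?thesis
      by (rule summable_on_cong_neutral[THEN iffD1, rotated -1]) auto
  qed
  have "(\<lambda>x. (\<lambda>(a :: nat, i). if a = 0 then (cmod (\<psi> i))\<^sup>2 else 0) x
      + (\<lambda>(a :: nat, i). if a = 1 then (cmod (\<phi> i))\<^sup>2 else 0) x) summable_on UNIV"
    using copy[OF sq(1), of 0] copy[OF sq(2), of 1] by (rule summable_on_add)
  moreover have "(\<lambda>x. (\<lambda>(a :: nat, i). if a = 0 then (cmod (\<psi> i))\<^sup>2 else 0) x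
      + (\<lambda>(a :: nat, i). if a = 1 then (cmod (\<phi> i))\<^sup>2 else 0) x) = (\<lambda>x. (cmod (\<xi> x))\<^sup>2)"
    by (auto simp: \<xi>_def fun_eq_iff)
  ultimately have "pos_trace_class (ketbra \<xi> \<xi>)"
    by (intro pos_trace_class_ketbra) simp
  moreover have "\<forall>a b i j. 2 \<le> a \<or> 2 \<le> b \<longrightarrow> ketbra \<xi> \<xi> (a, i) (b, j) = 0"
    by (auto simp: ketbra_def \<xi>_def)
  ultimately have psd: "pos_semidef (ampliation E (ketbra \<xi> \<xi>))"
    using cp unfolding completely_positive_def by blast
  have block: "(\<lambda>i' j'. ketbra \<xi> \<xi> (0, i') (0, j')) = ketbra \<psi> \<psi>"
    "(\<lambda>i' j'. ketbra \<xi> \<xi> (0, i') (1, j')) = ketbra \<psi> \<phi>"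
    "(\<lambda>i' j'. ketbra \<xi> \<xi> (1, i') (0, j')) = ketbra \<phi> \<psi>"
    "(\<lambda>i' j'. ketbra \<xi> \<xi> (1, i') (1, j')) = ketbra \<phi> \<phi>"
    by (simp_all add: ketbra_def \<xi>_def)
  \<comment> \<open>Testing block positivity on the indices \<open>(0, i)\<close> and
    \<open>(1, i)\<close> alone leaves a 2 by 2 matrix formed by the \<open>i\<close>-th diagonal
    entries of the four blocks.\<close>
  have "cnj c0 * E (ketbra \<psi> \<psi>) i i * c0 + cnj c0 * E (ketbra \<psi> \<phi>) i i * c1
      + cnj c1 * E (ketbra \<phi> \<psi>) i i * c0 + cnj c1 * E (ketbra \<phi> \<phi>) i i * c1 \<in> \<real>\<^sub>\<ge>\<^sub>0" for c0 c1
    using psd[unfolded pos_semidef_def, rule_format,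
        of "{(0, i), (1, i)}" "\<lambda>x. if fst x = 0 then c0 else c1"]
    by (simp add: ampliation_def block[simplified] add_ac)
  note psd2_offdiag_bound[OF this]
  then show "E (ketbra \<psi> \<psi>) i i \<in> \<real>\<^sub>\<ge>\<^sub>0" "E (ketbra \<phi> \<phi>) i i \<in> \<real>\<^sub>\<ge>\<^sub>0"
    "(cmod (E (ketbra \<psi> \<phi>) i i))\<^sup>2 \<le> Re (E (ketbra \<psi> \<psi>) i i) * Re (E (ketbra \<phi> \<phi>) i i)"
    by blast+
qed

text \<open>Monotonicity of the fidelity under the channel that keeps only the classical output.\<close>

lemma instrument_overlap_bound:
  fixes \<psi> \<phi> :: "'i vec" and E :: "'a::finite \<Rightarrow> 'i op \<Rightarrow> 'i op"
  assumes inst: "quantum_instrument E" and unit: "unit_vector \<psi>" "unit_vector \<phi>"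
    and P: "\<And>x. tr (E x (ketbra \<psi> \<psi>)) = complex_of_real (P x)"
    and Q: "\<And>x. tr (E x (ketbra \<phi> \<phi>)) = complex_of_real (Q x)"
  shows "cmod (tr (ketbra \<psi> \<phi>)) \<le> (\<Sum>x\<in>UNIV. sqrt (P x * Q x))"
proof -
  note sq = unit[THEN unit_vector_summable]
  have tc: "ketbra \<psi> \<psi> \<in> trace_class" "ketbra \<phi> \<phi> \<in> trace_class" "ketbra \<psi> \<phi> \<in> trace_class"
    using sq by (auto intro: trace_class_ketbra)
  have each: "cmod (tr (E x (ketbra \<psi> \<phi>))) \<le> sqrt (P x * Q x)" for x
  proof -
    have E: "completely_positive (E x)" "\<And>A. A \<in> trace_class \<Longrightarrow> E x A \<in> trace_class"
      using inst unfolding quantum_instrument_def trace_class_linear_def by auto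
    note diag = completely_positive_ketbra_diag[OF E(1) sq]
    let ?u = "\<lambda>i. Re (E x (ketbra \<psi> \<psi>) i i)" and ?v = "\<lambda>i. Re (E x (ketbra \<phi> \<phi>) i i)"
    let ?b = "\<lambda>i. E x (ketbra \<psi> \<phi>) i i"
    have nonneg: "0 \<le> ?u i" "0 \<le> ?v i" for i
      using diag(1,2)[of i] by (simp_all add: complex_nonneg_Reals_iff)
    have u: "(?u has_sum P x) UNIV"
      using has_sum_Re[OF has_sum_infsum[OF trace_class_summable_diag[OF E(2)[OF tc(1)]]]] P[of x]
      by (simp add: tr_def)
    have v: "(?v has_sum Q x) UNIV"
      using has_sum_Re[OF has_sum_infsum[OF trace_class_summable_diag[OF E(2)[OF tc(2)]]]] Q[of x]
      by (simp add: tr_def)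
    \<comment> \<open>The entrywise bound is summed by Cauchy-Schwarz. Working on finite sets also
      yields the absolute summability used next.\<close>
    have fin: "(\<Sum>i\<in>F. cmod (?b i)) \<le> sqrt (P x * Q x)" if "finite F" for F
    proof -
      have "(\<Sum>i\<in>F. cmod (?b i)) \<le> (\<Sum>i\<in>F. sqrt (?u i) * sqrt (?v i))"
        using diag(3) by (intro sum_mono) (auto simp flip: real_sqrt_mult intro: real_le_rsqrt)
      also have "\<dots> \<le> sqrt ((\<Sum>i\<in>F. (sqrt (?u i))\<^sup>2) * (\<Sum>i\<in>F. (sqrt (?v i))\<^sup>2))"
        by (intro real_le_rsqrt Cauchy_Schwarz_ineq_sum)
      also have "\<dots> = sqrt ((\<Sum>i\<in>F. ?u i) * (\<Sum>i\<in>F. ?v i))"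
        using nonneg by simp
      also have "\<dots> \<le> sqrt (P x * Q x)"
        using that nonneg u v
        by (intro real_sqrt_le_mono mult_mono finite_sum_le_has_sum has_sum_nonneg[OF u] sum_nonneg)
          auto
      finally show ?thesis .
    qed
    have abs: "(\<lambda>i. cmod (?b i)) summable_on UNIV"
      by (rule nonneg_bdd_above_summable_on) (auto intro!: bdd_aboveI2 fin)
    then have "cmod (tr (E x (ketbra \<psi> \<phi>))) \<le> (\<Sum>\<^sub>\<infinity>i. cmod (?b i))"
      unfolding tr_def by (rule norm_infsum_bound)
    also have "\<dots> \<le> sqrt (P x * Q x)"
      using abs fin by (rule infsum_le_finite_sums)
    finally show ?thesis .
  qed
  \<comment> \<open>Trace preservation on the off-diagonal operator splits the overlap into
    contributions of the outputs.\<close>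
  have "tr (ketbra \<psi> \<phi>) = (\<Sum>x\<in>UNIV. tr (E x (ketbra \<psi> \<phi>)))"
    using inst tc(3) unfolding quantum_instrument_def by simp
  then show ?thesis using each by (auto intro: order_trans[OF norm_sum] sum_mono)
qed

text \<open>
  The bound \<open>m\<close> is the largest eigenvalue of \<open>a |\<psi>\<rangle>\<langle>\<psi>| + b |\<phi>\<rangle>\<langle>\<phi>|\<close> when the overlap is exactly \<open>c\<close>.
\<close>

lemma two_state_expectation_bound:
  fixes \<psi> \<phi> v :: "'i vec" and a b c m :: real
  assumes unit: "unit_vector \<psi>" "unit_vector \<phi>" and overlap: "cmod (tr (ketbra \<psi> \<phi>)) \<le> c"
    and ab: "0 \<le> a" "0 \<le> b" "a + b = 1"
    and m: "1 / 2 \<le> m" "m * (1 - m) = a * b * (1 - c\<^sup>2)" and F: "finite F"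
  shows "a * (cmod (\<Sum>i\<in>F. cnj (v i) * \<psi> i))\<^sup>2 + b * (cmod (\<Sum>i\<in>F. cnj (v i) * \<phi> i))\<^sup>2
      \<le> m * (\<Sum>i\<in>F. (cmod (v i))\<^sup>2)"
proof -
  define x y where "x = (\<Sum>i\<in>F. cnj (v i) * \<psi> i)" and "y = (\<Sum>i\<in>F. cnj (v i) * \<phi> i)"
  define N where "N = a * (cmod x)\<^sup>2 + b * (cmod y)\<^sup>2"
  \<comment> \<open>Write T for the operator with weights \<open>a\<close>, \<open>b\<close>, and
    restrict \<open>v\<close> to \<open>F\<close>. Then \<open>w\<close> is T v, \<open>N\<close> is
    the expectation of T in \<open>v\<close>, and \<open>W\<close> is the squared norm of
    \<open>w\<close>. Cauchy-Schwarz bounds the square of \<open>N\<close> by \<open>?s * W\<close>;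
    it remains to see that \<open>W \<le> m * N\<close>.\<close>
  define w where "w i = a * cnj x * \<psi> i + b * cnj y * \<phi> i" for i
  define W where "W = a\<^sup>2 * (cmod x)\<^sup>2 + b\<^sup>2 * (cmod y)\<^sup>2
    + Re (2 * a * b * cnj x * y * tr (ketbra \<psi> \<phi>))"
  let ?s = "\<Sum>i\<in>F. (cmod (v i))\<^sup>2"
  have c: "0 \<le> c" using overlap norm_ge_zero order_trans by blast
  have N0: "0 \<le> N" using ab by (simp add: N_def)
  have "(\<Sum>i\<in>F. cnj (v i) * w i) =
      (\<Sum>i\<in>F. a * cnj x * (cnj (v i) * \<psi> i) + b * cnj y * (cnj (v i) * \<phi> i))"
    unfolding w_def by (intro sum.cong) (simp_all add: algebra_simps)
  also have "\<dots> = a * (x * cnj x) + b * (y * cnj y)"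
    unfolding sum.distrib sum_distrib_left[symmetric] x_def[symmetric] y_def[symmetric] by simp
  also have "\<dots> = complex_of_real N" by (simp only: N_def of_real_add of_real_mult complex_norm_square)
  finally have "N = cmod (\<Sum>i\<in>F. cnj (v i) * w i)" using N0 by simp
  also have "\<dots> \<le> (\<Sum>i\<in>F. cmod (v i) * cmod (w i))"
    by (rule order_trans[OF norm_sum]) (simp add: norm_mult)
  finally have "N\<^sup>2 \<le> (\<Sum>i\<in>F. cmod (v i) * cmod (w i))\<^sup>2" using N0 by (intro power_mono)
  also have "\<dots> \<le> ?s * (\<Sum>i\<in>F. (cmod (w i))\<^sup>2)" by (rule Cauchy_Schwarz_ineq_sum)
  also have "\<dots> \<le> ?s * W"
  proof (intro mult_left_mono finite_sum_le_has_sum)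
    have g: "((\<lambda>i. \<psi> i * cnj (\<phi> i)) has_sum tr (ketbra \<psi> \<phi>)) UNIV"
      using summable_on_inner[OF unit[THEN unit_vector_summable]]
      by (simp add: tr_def ketbra_def)
    have "((\<lambda>i. (a\<^sup>2 * (cmod x)\<^sup>2) * (cmod (\<psi> i))\<^sup>2 + (b\<^sup>2 * (cmod y)\<^sup>2) * (cmod (\<phi> i))\<^sup>2
        + Re ((2 * a * b * cnj x * y) * (\<psi> i * cnj (\<phi> i)))) has_sum
        ((a\<^sup>2 * (cmod x)\<^sup>2) * 1 + (b\<^sup>2 * (cmod y)\<^sup>2) * 1
        + Re ((2 * a * b * cnj x * y) * tr (ketbra \<psi> \<phi>)))) UNIV"
      using unit g unfolding unit_vector_def
      by (intro has_sum_add has_sum_Re has_sum_cmult_right)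
    moreover have "(a\<^sup>2 * (cmod x)\<^sup>2) * (cmod (\<psi> i))\<^sup>2 + (b\<^sup>2 * (cmod y)\<^sup>2) * (cmod (\<phi> i))\<^sup>2
        + Re ((2 * a * b * cnj x * y) * (\<psi> i * cnj (\<phi> i))) = (cmod (w i))\<^sup>2" for i
      unfolding w_def cmod_power2 by (simp add: power2_eq_square algebra_simps)
    ultimately show "((\<lambda>i. (cmod (w i))\<^sup>2) has_sum W) UNIV" by (simp add: W_def)
  qed (use F in \<open>auto intro: sum_nonneg\<close>)
  also have "\<dots> \<le> ?s * (m * N)"
  proof (intro mult_left_mono sum_nonneg)
    let ?X = "cmod x" and ?Y = "cmod y"
    have "Re (2 * a * b * cnj x * y * tr (ketbra \<psi> \<phi>)) \<le> 2 * a * b * ?X * ?Y * cmod (tr (ketbra \<psi> \<phi>))"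
      using complex_Re_le_cmod[of "2 * a * b * cnj x * y * tr (ketbra \<psi> \<phi>)"] ab
      by (simp add: norm_mult)
    also have "\<dots> \<le> 2 * a * b * ?X * ?Y * c"
      using overlap ab by (intro mult_left_mono) auto
    finally have W: "W \<le> a\<^sup>2 * ?X\<^sup>2 + b\<^sup>2 * ?Y\<^sup>2 + 2 * a * b * ?X * ?Y * c" by (simp add: W_def)
    \<comment> \<open>The equation for \<open>m\<close> is the characteristic equation of the Gram
      matrix of the two weighted vectors at overlap \<open>c\<close>.\<close>
    have prod: "(m - a) * (m - b) = a * b * c\<^sup>2" using m(2) ab(3) by algebra
    have "0 \<le> (m - a) * (m - b)" unfolding prod using ab by simp
    moreover have "0 \<le> (m - a) + (m - b)" using m ab by simp
    ultimately have ma: "0 \<le> m - a" "0 \<le> m - b"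
      by (auto simp: zero_le_mult_iff)
    have "(sqrt (a * (m - a)) * sqrt (b * (m - b))) = sqrt ((a * b) * ((m - a) * (m - b)))"
      by (simp add: real_sqrt_mult[symmetric] mult_ac)
    also have "\<dots> = sqrt ((a * b * c)\<^sup>2)" unfolding prod by (simp add: power2_eq_square mult_ac)
    finally have sq: "sqrt (a * (m - a)) * sqrt (b * (m - b)) = a * b * c"
      using ab c by simp
    \<comment> \<open>By \<open>sq\<close> this square is \<open>m * N\<close> minus the upper bound
      on \<open>W\<close>.\<close>
    have "0 \<le> (sqrt (a * (m - a)) * ?X - sqrt (b * (m - b)) * ?Y)\<^sup>2" by simp
    also have "\<dots> = a * (m - a) * ?X\<^sup>2 + b * (m - b) * ?Y\<^sup>2
        - 2 * (sqrt (a * (m - a)) * sqrt (b * (m - b))) * ?X * ?Y"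
      using ab ma by (simp add: power2_diff power_mult_distrib)
    finally show "W \<le> m * N" using W unfolding sq by (simp add: N_def algebra_simps power2_eq_square)
  qed auto
  finally have "N * N \<le> (m * ?s) * N" by (simp add: power2_eq_square mult_ac)
  moreover have "0 \<le> m * ?s" using m by (intro mult_nonneg_nonneg sum_nonneg) auto
  ultimately have "N \<le> m * ?s" using N0 by (cases "N = 0") auto
  then show ?thesis by (simp add: N_def x_def y_def)
qed

section \<open>Spectral decompositions\<close>

lemma has_sum_sum_index:
  fixes f :: "'b \<Rightarrow> 'a \<Rightarrow> 'c :: topological_comm_monoid_add"
  assumes "finite I" "\<And>i. i \<in> I \<Longrightarrow> (f i has_sum s i) A"
  shows "((\<lambda>x. \<Sum>i\<in>I. f i x) has_sum (\<Sum>i\<in>I. s i)) A"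
  using assms by (induction I) (auto intro: has_sum_add)

lemma orthonormal_has_sum_norm:
  assumes "orthonormal e"
  shows "((\<lambda>i. (cmod (e k i))\<^sup>2) has_sum 1) UNIV"
proof -
  have "((\<lambda>i. complex_of_real ((cmod (e k i))\<^sup>2)) has_sum complex_of_real 1) UNIV"
    unfolding complex_norm_square
    using assms[unfolded orthonormal_def, rule_format, of k k] by (simp add: mult.commute)
  then show ?thesis by (simp only: has_sum_of_real_iff)
qed

text \<open>The expectation bound concerns finitely supported vectors, so it is applied to
  truncations of the eigenvector \<open>e k\<close>. If the truncation has squared norm
  \<open>s\<close>, the expectation is at least \<open>lam k * s\<^sup>2\<close> and at most
  \<open>m * s\<close>; then \<open>s\<close> tends to 1.\<close>

lemma spectral_eigenvalue_le:
  assumes spec: "spectral_decomposition \<rho> lam e" and m: "0 \<le> m"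
    and bound: "\<And>F v. finite F \<Longrightarrow> Re (\<Sum>i\<in>F. \<Sum>j\<in>F. cnj (v i) * \<rho> i j * v j) \<le> m * (\<Sum>i\<in>F. (cmod (v i))\<^sup>2)"
  shows "lam k \<le> m"
proof -
  have lam: "\<And>l. 0 \<le> lam l" and orth: "orthonormal e"
    and dec: "\<And>i j. ((\<lambda>l. complex_of_real (lam l) * ketbra (e l) (e l) i j) has_sum \<rho> i j) UNIV"
    using spec unfolding spectral_decomposition_def by auto
  have unit: "((\<lambda>i. (cmod (e k i))\<^sup>2) has_sum 1) UNIV"
    using orth by (rule orthonormal_has_sum_norm)
  have fin: "(\<Sum>i\<in>F. lam k * (cmod (e k i))\<^sup>2) \<le> m" if F: "finite F" for F
  proof -
    define v where "v = e k"
    define s where "s = (\<Sum>i\<in>F. (cmod (v i))\<^sup>2)"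
    have s: "0 \<le> s" by (simp add: s_def sum_nonneg)
    define z where "z l = (\<Sum>i\<in>F. cnj (v i) * e l i)" for l
    have "((\<lambda>l. \<Sum>i\<in>F. \<Sum>j\<in>F. cnj (v i) * (complex_of_real (lam l) * ketbra (e l) (e l) i j) * v j)
        has_sum (\<Sum>i\<in>F. \<Sum>j\<in>F. cnj (v i) * \<rho> i j * v j)) UNIV"
      by (intro has_sum_sum_index F has_sum_cmult_left has_sum_cmult_right dec)
    moreover have "(\<Sum>i\<in>F. \<Sum>j\<in>F. cnj (v i) * (complex_of_real (lam l) * ketbra (e l) (e l) i j) * v j)
        = complex_of_real (lam l * (cmod (z l))\<^sup>2)" for l
      unfolding of_real_mult z_def ketbra_form[symmetric] sum_distrib_left by (simp add: mult_ac)
    ultimately have "((\<lambda>l. complex_of_real (lam l * (cmod (z l))\<^sup>2)) has_sum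
        (\<Sum>i\<in>F. \<Sum>j\<in>F. cnj (v i) * \<rho> i j * v j)) UNIV" by simp
    then have hs: "((\<lambda>l. lam l * (cmod (z l))\<^sup>2) has_sum
        Re (\<Sum>i\<in>F. \<Sum>j\<in>F. cnj (v i) * \<rho> i j * v j)) UNIV"
      by (auto dest: has_sum_Re)
    have "z k = complex_of_real s"
      unfolding z_def s_def v_def by (simp only: of_real_sum complex_norm_square) (simp add: mult.commute)
    then have "lam k * s\<^sup>2 = (\<Sum>l\<in>{k}. lam l * (cmod (z l))\<^sup>2)" by simp
    also have "\<dots> \<le> Re (\<Sum>i\<in>F. \<Sum>j\<in>F. cnj (v i) * \<rho> i j * v j)"
      by (rule finite_sum_le_has_sum[OF hs]) (use lam in auto)
    also have "\<dots> \<le> m * s" unfolding s_def by (rule bound[OF F])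
    finally have "(lam k * s) * s \<le> m * s" by (simp add: power2_eq_square mult.assoc)
    then have "lam k * s \<le> m" using s m by (cases "s = 0") auto
    then show ?thesis by (simp add: s_def v_def sum_distrib_left)
  qed
  have "((\<lambda>i. lam k * (cmod (e k i))\<^sup>2) has_sum lam k * 1) UNIV"
    using unit by (rule has_sum_cmult_right)
  then have "lam k * 1 \<le> m" using fin by (rule has_sum_le_finite_sums)
  then show ?thesis by simp
qed

text \<open>Each \<open>e l\<close> has norm 1, so the eigenvalues sum to a double sum of
  nonnegative terms, which Tonelli turns into the sum of the diagonal of \<rho>.\<close>

lemma spectral_eigenvalues_sum:
  fixes \<rho> :: "'i::countable op"
  assumes spec: "spectral_decomposition \<rho> lam e"
    and trace: "((\<lambda>i. Re (\<rho> i i)) has_sum 1) UNIV"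
  shows "(lam has_sum 1) UNIV"
proof -
  have lam: "\<And>l. 0 \<le> lam l" and orth: "orthonormal e"
    and dec: "\<And>i j. ((\<lambda>l. complex_of_real (lam l) * ketbra (e l) (e l) i j) has_sum \<rho> i j) UNIV"
    using spec unfolding spectral_decomposition_def by auto
  have diag: "((\<lambda>l. lam l * (cmod (e l i))\<^sup>2) has_sum Re (\<rho> i i)) UNIV" for i
  proof -
    have "((\<lambda>l. complex_of_real (lam l * (cmod (e l i))\<^sup>2)) has_sum \<rho> i i) UNIV"
      unfolding of_real_mult complex_norm_square using dec[of i i] by (simp add: ketbra_def)
    then show ?thesis by (auto dest: has_sum_Re)
  qed
  have \<rho>: "0 \<le> Re (\<rho> i i)" for i
    by (rule has_sum_nonneg[OF diag]) (simp add: lam)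
  have "(\<integral>\<^sup>+l. ennreal (lam l) \<partial>count_space UNIV)
      = (\<integral>\<^sup>+l. \<integral>\<^sup>+i. ennreal (lam l * (cmod (e l i))\<^sup>2) \<partial>count_space UNIV \<partial>count_space UNIV)"
  proof (rule nn_integral_cong)
    fix l
    have "((\<lambda>i. lam l * (cmod (e l i))\<^sup>2) has_sum lam l * 1) UNIV"
      by (intro has_sum_cmult_right orthonormal_has_sum_norm orth)
    then show "ennreal (lam l) = (\<integral>\<^sup>+i. ennreal (lam l * (cmod (e l i))\<^sup>2) \<partial>count_space UNIV)"
      using lam by (subst (asm) has_sum_nonneg_iff_nn_integral) auto
  qed
  also have "\<dots> = (\<integral>\<^sup>+i. \<integral>\<^sup>+l. ennreal (lam l * (cmod (e l i))\<^sup>2) \<partial>count_space UNIV \<partial>count_space UNIV)"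
    by (rule nn_integral_count_space_nn_integral) auto
  also have "\<dots> = (\<integral>\<^sup>+i. ennreal (Re (\<rho> i i)) \<partial>count_space UNIV)"
    using diag \<rho> lam by (intro nn_integral_cong, subst (asm) has_sum_nonneg_iff_nn_integral) auto
  also have "\<dots> = ennreal 1"
    using trace \<rho> by (subst (asm) has_sum_nonneg_iff_nn_integral) auto
  finally show ?thesis using lam by (subst has_sum_nonneg_iff_nn_integral) auto
qed

section \<open>Pasts of the heralding coin\<close>

lemma unit_vector_cmod_le_1:
  assumes "unit_vector \<psi>"
  shows "cmod (\<psi> i) \<le> 1"
proof -
  have "(\<Sum>j\<in>{i}. (cmod (\<psi> j))\<^sup>2) \<le> 1"
    by (rule finite_sum_le_has_sum[OF assms[unfolded unit_vector_def]]) auto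
  then show ?thesis by (simp add: power_le_one_iff)
qed

locale heralding_coin =
  fixes p q :: real and M :: "(int \<Rightarrow> trit) measure"
  assumes p: "0 < p" "p \<le> 1" and q: "0 < q" "q \<le> 1" and proc: "heralding_process p q M"
begin

abbreviation "T \<equiv> heralding_machine p q"
abbreviation "\<mu> \<equiv> past_law M"

definition "w0 = q / (p + q)"
definition "w1 = p / (p + q)"

lemma weights: "0 < w0" "0 < w1" "w0 + w1 = 1"
  using p q by (auto simp: w0_def w1_def add_divide_distrib[symmetric])

lemma measure_cyl: "measure M (cyl t w) = w0 * emit_prob T S0 w + w1 * emit_prob T S1 w"
proof -
  obtain \<pi> where \<pi>: "\<And>t w. measure M (cyl t w) = (\<Sum>s\<in>UNIV. \<pi> s * emit_prob T s w)"
    and sd: "stationary_dist T \<pi>"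
    using proc unfolding heralding_process_def stationary_process_of_def by blast
  then show ?thesis
    using stationary_dist_heralding[OF sd] p q by (simp add: UNIV_coin_state w0_def w1_def)
qed

text \<open>The update condition of a model refers to the encoding of the extended past, which is
  known only on \<open>pasts M\<close>. A window of the extended past is a window of
  \<open>h\<close> followed by \<open>x\<close>, so its probability factors.\<close>

lemma past_snoc_in_pasts:
  assumes h: "h \<in> pasts M" and x: "0 < cond_future M h [x]"
  shows "past_snoc h x \<in> pasts M"
  unfolding pasts_def
proof (intro CollectI allI)
  fix n
  have ex: "0 < emit_prob T (st (h 0)) [x]"
    using x by (simp only: cond_future_heralding[OF proc h])
  show "0 < measure M (past_window (past_snoc h x) n)"
  proof (cases n)
    case 0
    have "0 < measure M (past_window h 0)" using h by (simp only: pasts_def mem_Collect_eq)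
    then show ?thesis using 0 by (simp add: past_window_def)
  next
    case (Suc m)
    have "window_word (past_snoc h x) (Suc m) = window_word h m @ [x]"
      by (simp add: window_word_def past_snoc_def map_upt_Suc del: upt_Suc)
    then have eq: "measure M (past_window (past_snoc h x) n) =
        w0 * emit_prob T S0 (window_word h m @ [x]) + w1 * emit_prob T S1 (window_word h m @ [x])"
      unfolding past_window_eq measure_cyl Suc by simp
    show ?thesis
    proof (cases m)
      case 0
      \<comment> \<open>The window of \<open>h\<close> is empty here and \<open>emit_append\<close>
        does not apply; positivity comes from the summand of the state
        \<open>st (h 0)\<close>.\<close>
      have nonneg: "0 \<le> emit_prob T s [x]" for s
        using p q by (intro emit_nonneg) auto
      have "0 < w0 * emit_prob T S0 [x] + w1 * emit_prob T S1 [x]"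
        using ex weights nonneg[of S0] nonneg[of S1]
        by (cases "st (h 0)") (auto intro: add_pos_nonneg add_nonneg_pos simp del: emit_prob.simps)
      then show ?thesis unfolding eq using 0 by (simp add: window_word_def del: emit_prob.simps)
    next
      case (Suc k)
      have ne: "window_word h m \<noteq> []" and last: "last (window_word h m) = h 0"
        using Suc by (auto simp: window_word_def last_rev hd_map simp del: upt_Suc)
      have "measure M (past_window (past_snoc h x) n) =
          measure M (past_window h m) * emit_prob T (st (h 0)) [x]"
        unfolding eq past_window_eq[of h m] measure_cyl emit_append[OF ne] last
        by (simp add: algebra_simps del: emit_prob.simps)
      then show ?thesis using h ex by (simp add: pasts_def del: emit_prob.simps)
    qed
  qed
qed

section \<open>Measurability of the pasts and weights of the causal states\<close>

lemma prob_space_M: "prob_space M" and sets_M: "sets M = sets (seq_space UNIV)"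
  using proc unfolding heralding_process_def stationary_process_of_def stationary_process_def by auto

lemma space_M: "space M = UNIV"
  using sets_eq_imp_space_eq[OF sets_M] by (simp add: seq_space_def space_PiM)

lemma measurable_past_of: "past_of \<in> measurable M (seq_space UNIV)"
proof -
  have "past_of \<in> measurable (seq_space UNIV) (seq_space UNIV)"
    unfolding past_of_def seq_space_def
    by (rule measurable_PiM_single') (auto simp: measurable_component_singleton)
  then show ?thesis using measurable_cong_sets[OF sets_M refl] by auto
qed

lemma space_\<mu>: "space \<mu> = UNIV"
  by (simp add: past_law_def seq_space_def space_PiM)

lemma prob_space_\<mu>: "prob_space \<mu>"
  unfolding past_law_def by (intro prob_space.prob_space_distr prob_space_M measurable_past_of)

sublocale \<mu>: prob_space \<mu>
  by (rule prob_space_\<mu>)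

lemma coordinate_measurable: "(\<lambda>g. g k) \<in> measurable \<mu> (count_space UNIV)"
proof -
  have "(\<lambda>g. g k) \<in> measurable (seq_space UNIV) (count_space UNIV :: 'a measure)"
    unfolding seq_space_def by (rule measurable_component_singleton) simp
  then show ?thesis unfolding past_law_def by simp
qed

lemma UNIV_measurable: "UNIV \<in> sets \<mu>"
  using sets.top[of \<mu>] unfolding space_\<mu> .

lemma prefix_measurable: "{g. \<forall>k<n. g k = h k} \<in> sets \<mu>"
proof (induction n)
  case 0
  have "{g. \<forall>k<0. g k = h k} = UNIV" by simp
  then show ?case using UNIV_measurable by (simp only:)
next
  case (Suc n)
  have "{g. g n = h n} \<in> sets \<mu>"
    using measurable_sets[OF coordinate_measurable, of "{h n}" n] by (simp add: space_\<mu> vimage_def)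
  moreover have "{g. \<forall>k<Suc n. g k = h k} = {g. \<forall>k<n. g k = h k} \<inter> {g. g n = h n}"
    by (auto simp: less_Suc_eq)
  ultimately show ?case using Suc by auto
qed

lemma measure_prefix: "measure \<mu> {g. \<forall>k<n. g k = h k} = measure M (past_window h n)"
proof -
  have "measure \<mu> {g. \<forall>k<n. g k = h k} = measure M (past_of -` {g. \<forall>k<n. g k = h k} \<inter> space M)"
    using prefix_measurable[of n h] unfolding past_law_def
    by (intro measure_distr measurable_past_of) auto
  also have "past_of -` {g. \<forall>k<n. g k = h k} \<inter> space M = past_window h n"
    by (auto simp: space_M past_window_def)
  finally show ?thesis .
qed

text \<open>Whether the window of length \<open>n\<close> has positive probability depends only on
  its first \<open>n\<close> symbols. Hence \<open>pasts M\<close> is built from cylinders by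
  countable operations and is measurable.\<close>

lemma pasts_eq: "pasts M = (\<Inter>n. \<Union>w\<in>{w. length w = n \<and> 0 < measure M (past_window ((!) w) n)}.
    {g. \<forall>k<n. g k = w ! k})" (is "_ = ?R")
proof (intro set_eqI iffI)
  fix h assume h: "h \<in> pasts M"
  have "h \<in> (\<Union>w\<in>{w. length w = n \<and> 0 < measure M (past_window ((!) w) n)}. {g. \<forall>k<n. g k = w ! k})" for n
  proof (rule UN_I[of "map h [0..<n]"])
    have "past_window ((!) (map h [0..<n])) n = past_window h n" by (simp add: past_window_def)
    then show "map h [0..<n] \<in> {w. length w = n \<and> 0 < measure M (past_window ((!) w) n)}"
      using h by (simp add: pasts_def)
  qed simp
  then show "h \<in> ?R" by blast
next
  fix h assume "h \<in> ?R"
  then have "\<exists>w. 0 < measure M (past_window ((!) w) n) \<and> (\<forall>k<n. h k = w ! k)" for n by blast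
  then have "0 < measure M (past_window h n)" for n
    unfolding past_window_def by (smt (verit) Collect_cong)
  then show "h \<in> pasts M" by (simp add: pasts_def)
qed

lemma pasts_measurable: "pasts M \<in> sets \<mu>"
  unfolding pasts_eq
  using UNIV_measurable by (intro sets.countable_INT'' sets.countable_UN'' prefix_measurable) auto

text \<open>There are countably many finite words, so almost every past avoids all cylinders of
  probability zero at once.\<close>

lemma AE_pasts: "AE h in \<mu>. h \<in> pasts M"
proof -
  have "AE h in \<mu>. \<not> (\<forall>k<length w. h k = w ! k)"
    if "measure M (past_window ((!) w) (length w)) = 0" for w :: "trit list"
  proof -
    have "{g. \<forall>k<length w. g k = w ! k} \<in> null_sets \<mu>"
      using that prefix_measurable[of "length w" "(!) w"] measure_prefix[of "length w" "(!) w"]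
      by (intro null_setsI) (auto simp: \<mu>.emeasure_eq_measure)
    then show ?thesis using AE_not_in by fastforce
  qed
  then have "AE h in \<mu>. \<forall>w. measure M (past_window ((!) w) (length w)) = 0 \<longrightarrow>
      \<not> (\<forall>k<length w. h k = w ! k)"
    by (subst AE_all_countable) (auto simp: AE_impI)
  then show ?thesis
  proof eventually_elim
    case (elim h)
    have "measure M (past_window h n) \<noteq> 0" for n
    proof -
      have "past_window ((!) (map h [0..<n])) n = past_window h n" by (simp add: past_window_def)
      then show ?thesis using elim[rule_format, of "map h [0..<n]"] by auto
    qed
    then show ?case by (simp add: pasts_def zero_less_measure_iff)
  qed
qed

lemma causal_state_measurable: "s0_plus M \<in> sets \<mu>" "s1_plus M \<in> sets \<mu>"
proof -
  have A: "{h. h 0 = T1} \<in> sets \<mu>"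
    using prefix_measurable[of 1 "\<lambda>_. T1"] by simp
  have "s1_plus M = pasts M \<inter> {h. h 0 = T1}" "s0_plus M = pasts M - {h. h 0 = T1}"
    by (auto simp: s0_plus_def s1_plus_def)
  then show "s0_plus M \<in> sets \<mu>" "s1_plus M \<in> sets \<mu>"
    using A pasts_measurable by auto
qed

lemma measure_causal_state: "measure \<mu> (s0_plus M) = w0" "measure \<mu> (s1_plus M) = w1"
proof -
  have A: "{h. h 0 = T1} \<in> sets \<mu>"
    using prefix_measurable[of 1 "\<lambda>_. T1"] by simp
  have "measure \<mu> (s1_plus M) = measure \<mu> {h. h 0 = T1}"
  proof (rule \<mu>.finite_measure_eq_AE)
    show "AE h in \<mu>. h \<in> s1_plus M \<longleftrightarrow> h \<in> {h. h 0 = T1}"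
      using AE_pasts by eventually_elim (simp add: s1_plus_def)
  qed (use A causal_state_measurable in auto)
  also have "\<dots> = measure M (past_window (\<lambda>_. T1) 1)"
    using measure_prefix[of 1 "\<lambda>_. T1"] by simp
  also have "\<dots> = w0 * p + w1 * (1 - q)"
    unfolding past_window_eq measure_cyl by (simp add: window_word_def UNIV_coin_state)
  also have "\<dots> = w1"
  proof -
    \<comment> \<open>The balance equation of the stationary two-state chain.\<close>
    have "w0 * p = w1 * q" by (simp add: w0_def w1_def)
    then show ?thesis by (simp add: algebra_simps)
  qed
  finally show 1: "measure \<mu> (s1_plus M) = w1" .
  have "measure \<mu> (s0_plus M \<union> s1_plus M) = measure \<mu> (s0_plus M) + measure \<mu> (s1_plus M)"
    using causal_state_measurable
    by (intro \<mu>.finite_measure_Union) (auto simp: s0_plus_def s1_plus_def)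
  moreover have "s0_plus M \<union> s1_plus M = pasts M"
    by (auto simp: s0_plus_def s1_plus_def)
  moreover have "measure \<mu> (pasts M) = 1"
    using \<mu>.prob_eq_1[OF pasts_measurable] AE_pasts by simp
  ultimately show "measure \<mu> (s0_plus M) = w0" using 1 weights by simp
qed

lemma emit_prob_single: "emit_prob T s [x] = T s x (st x)"
  unfolding emit_Cons by simp

end

section \<open>The quantum model of the heralding coin\<close>

lemma pos_semidef_diag: "pos_semidef A \<Longrightarrow> A x x \<in> \<real>\<^sub>\<ge>\<^sub>0"
  unfolding pos_semidef_def by (drule spec[of _ "{x}"], drule spec[of _ "\<lambda>_. 1"]) simp

lemma pos_semidef_scale:
  fixes A :: "'i op"
  assumes "pos_semidef A" "c \<in> \<real>\<^sub>\<ge>\<^sub>0"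
  shows "pos_semidef (\<lambda>i j. c * A i j)"
  unfolding pos_semidef_def
proof (intro allI impI)
  fix F :: "'i set" and d :: "'i \<Rightarrow> complex"
  assume "finite F"
  then have "c * (\<Sum>i\<in>F. \<Sum>j\<in>F. cnj (d i) * A i j * d j) \<in> \<real>\<^sub>\<ge>\<^sub>0"
    using assms unfolding pos_semidef_def by (intro nonneg_Reals_mult_I) auto
  then show "(\<Sum>i\<in>F. \<Sum>j\<in>F. cnj (d i) * (c * A i j) * d j) \<in> \<real>\<^sub>\<ge>\<^sub>0"
    by (simp add: sum_distrib_left mult_ac)
qed

text \<open>The ampliated output is the compression of \<open>A\<close> to the index
  \<open>x\<close>, tensored with the projector on \<open>s\<close>. Contracting a test vector with
  \<open>s\<close> turns its form into the form of \<open>A\<close> on the indices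
  \<open>(a, x)\<close>.\<close>

lemma completely_positive_measure_prepare:
  fixes s :: "'i::finite vec"
  shows "completely_positive (\<lambda>A i j. A x x * ketbra s s i j)"
  unfolding completely_positive_def
proof (intro allI impI)
  fix n and A :: "(nat \<times> 'i) op"
  assume "pos_trace_class A \<and> (\<forall>a b i j. n \<le> a \<or> n \<le> b \<longrightarrow> A (a, i) (b, j) = 0)"
  then have A: "pos_semidef A" by (simp add: pos_trace_class_def)
  show "pos_semidef (ampliation (\<lambda>A i j. A x x * ketbra s s i j) A)"
    unfolding pos_semidef_def
  proof (intro allI impI)
    fix F :: "(nat \<times> 'i) set" and c :: "nat \<times> 'i \<Rightarrow> complex"
    assume F: "finite F"
    define G where "G = fst ` F"
    \<comment> \<open>Extension by zero lets the sums run over the rectangle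
      \<open>G \<times> UNIV\<close>, where the two components separate.\<close>
    define c' where "c' y = (if y \<in> F then c y else 0)" for y
    define d where "d a = (\<Sum>i\<in>UNIV. cnj (s i) * c' (a, i))" for a
    let ?P = "ampliation (\<lambda>A i j. A x x * ketbra s s i j) A"
    have G: "finite G" using F by (simp add: G_def)
    have sub: "F \<subseteq> G \<times> UNIV" unfolding G_def by force
    have "(\<Sum>y\<in>F. \<Sum>z\<in>F. cnj (c y) * ?P y z * c z) = (\<Sum>y\<in>F. \<Sum>z\<in>G \<times> UNIV. cnj (c y) * ?P y z * c' z)"
      using sub F G by (intro sum.cong refl sum.mono_neutral_cong_left) (auto simp: c'_def)
    also have "\<dots> = (\<Sum>y\<in>G \<times> UNIV. \<Sum>z\<in>G \<times> UNIV. cnj (c' y) * ?P y z * c' z)"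
      using sub F G by (intro sum.mono_neutral_cong_left) (auto simp: c'_def)
    also have "\<dots> = (\<Sum>a\<in>G. \<Sum>i\<in>UNIV. \<Sum>b\<in>G. \<Sum>j\<in>UNIV. cnj (c' (a, i)) * ?P (a, i) (b, j) * c' (b, j))"
      by (simp add: sum.cartesian_product' )
    also have "\<dots> = (\<Sum>a\<in>G. \<Sum>b\<in>G. \<Sum>i\<in>UNIV. \<Sum>j\<in>UNIV. cnj (c' (a, i)) * ?P (a, i) (b, j) * c' (b, j))"
      by (intro sum.cong refl sum.swap)
    also have "\<dots> = (\<Sum>a\<in>G. \<Sum>b\<in>G. cnj (d a) * A (a, x) (b, x) * d b)"
    proof (intro sum.cong refl)
      fix a b
      have "cnj (d a) * A (a, x) (b, x) * d b = A (a, x) (b, x) * (cnj (d a) * d b)" by simp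
      also have "\<dots> = (\<Sum>i\<in>UNIV. \<Sum>j\<in>UNIV. cnj (c' (a, i)) * ?P (a, i) (b, j) * c' (b, j))"
        unfolding d_def cnj_sum sum_product unfolding sum_distrib_left
        by (simp add: ampliation_def ketbra_def mult_ac)
      finally show "(\<Sum>i\<in>UNIV. \<Sum>j\<in>UNIV. cnj (c' (a, i)) * ?P (a, i) (b, j) * c' (b, j)) =
          cnj (d a) * A (a, x) (b, x) * d b" by (rule sym)
    qed
    also have "\<dots> = (\<Sum>y\<in>(\<lambda>a. (a, x)) ` G. \<Sum>z\<in>(\<lambda>a. (a, x)) ` G. cnj (d (fst y)) * A y z * d (fst z))"
      by (simp add: sum.reindex inj_on_def)
    also have "\<dots> \<in> \<real>\<^sub>\<ge>\<^sub>0"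
      by (rule A[unfolded pos_semidef_def, rule_format, OF finite_imageI[OF G]])
    finally show "(\<Sum>y\<in>F. \<Sum>z\<in>F. cnj (c y) * ?P y z * c z) \<in> \<real>\<^sub>\<ge>\<^sub>0" .
  qed
qed

lemma tr_ketbra_unit:
  assumes "unit_vector s"
  shows "tr (ketbra s s) = 1"
proof -
  have "((\<lambda>i. complex_of_real ((cmod (s i))\<^sup>2)) has_sum complex_of_real 1) UNIV"
    using assms unfolding unit_vector_def by (rule has_sum_of_real)
  then have "((\<lambda>i. ketbra s s i i) has_sum 1) UNIV"
    unfolding complex_norm_square by (simp add: ketbra_def)
  then show ?thesis unfolding tr_def by (rule infsumI)
qed

lemma tr_cmult: "tr (\<lambda>i j. c * A i j) = c * tr A"
  unfolding tr_def by (rule infsum_cmult_right')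

text \<open>The heralding circuit turns out to act in this way, so the instrument axioms can be
  checked on this form instead of on the circuit.\<close>

lemma quantum_instrument_measure_prepare:
  fixes s :: "'i::finite \<Rightarrow> 'i vec"
  assumes unit: "\<And>x. unit_vector (s x)"
  shows "quantum_instrument (\<lambda>x A i j. A x x * ketbra (s x) (s x) i j)"
proof -
  let ?E = "\<lambda>x A i j. A x x * ketbra (s x) (s x) i j"
  have pos: "pos_trace_class (?E x A)" if "pos_trace_class A" for x A
    using that unfolding pos_trace_class_def
    by (intro conjI pos_semidef_scale pos_semidef_ketbra pos_semidef_diag summable_on_finite) auto
  have "?E x A \<in> trace_class" if tc: "A \<in> trace_class" for x A
  proof -
    obtain P Q R S where PQRS: "pos_trace_class P" "pos_trace_class Q" "pos_trace_class R"
        "pos_trace_class S" and A: "A = (\<lambda>i j. P i j - Q i j + \<i> * (R i j - S i j))"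
      using tc unfolding trace_class_def by blast
    from A have decomp: "?E x A = (\<lambda>i j. ?E x P i j - ?E x Q i j + \<i> * (?E x R i j - ?E x S i j))"
      by (simp add: algebra_simps)
    show ?thesis unfolding trace_class_def
      by (intro CollectI exI conjI, rule decomp) (intro pos PQRS)+
  qed
  then have "trace_class_linear (?E x)" for x
    unfolding trace_class_linear_def by (auto simp: algebra_simps)
  moreover have "(\<Sum>x\<in>UNIV. tr (?E x A)) = tr A" for A
    unfolding tr_cmult tr_ketbra_unit[OF unit] by (simp add: tr_def)
  ultimately show ?thesis
    unfolding quantum_instrument_def by (auto intro: completely_positive_measure_prepare)
qed

text \<open>Preparation of the ancilla, the controlled gate and the projection onto an outcome are
  all block diagonal for the basis of the first system. Each of them therefore preserves the shape
  of the joint operator and only replaces the ancilla vector \<open>\<phi> i\<close> by its image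
  under the block \<open>B i\<close>.\<close>

lemma conjugate_by_block_diagonal:
  fixes B :: "'i::finite \<Rightarrow> 'k::finite op"
  assumes D: "D = (\<lambda>(w, a) (w', b). if w = w' then B w a b else 0)"
  shows "conjugate_by D (\<lambda>(i, a) (j, b). \<rho> i j * \<phi> i a * cnj (\<phi> j b)) =
    (\<lambda>(i, a) (j, b). \<rho> i j * op_apply (B i) (\<phi> i) a * cnj (op_apply (B j) (\<phi> j) b))"
proof -
  have D': "D (i, a) (k, c) = (if k = i then B i a c else 0)" for i a k c by (simp add: D)
  have delta: "(\<Sum>kc\<in>UNIV. D (i, a) kc * f kc) = (\<Sum>c\<in>UNIV. B i a c * f (i, c))"
    "(\<Sum>kc\<in>UNIV. f kc * cnj (D (i, a) kc)) = (\<Sum>c\<in>UNIV. f (i, c) * cnj (B i a c))" for i a f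
  proof -
    have "(\<Sum>kc\<in>UNIV. D (i, a) kc * f kc) = (\<Sum>k\<in>UNIV. \<Sum>c\<in>UNIV. D (i, a) (k, c) * f (k, c))"
      by (simp add: sum.cartesian_product)
    also have "\<dots> = (\<Sum>k\<in>UNIV. if k = i then \<Sum>c\<in>UNIV. B i a c * f (i, c) else 0)"
      unfolding D' by (intro sum.cong) auto
    finally show "(\<Sum>kc\<in>UNIV. D (i, a) kc * f kc) = (\<Sum>c\<in>UNIV. B i a c * f (i, c))" by simp
    have "(\<Sum>kc\<in>UNIV. f kc * cnj (D (i, a) kc)) = (\<Sum>k\<in>UNIV. \<Sum>c\<in>UNIV. f (k, c) * cnj (D (i, a) (k, c)))"
      by (simp add: sum.cartesian_product)
    also have "\<dots> = (\<Sum>k\<in>UNIV. if k = i then \<Sum>c\<in>UNIV. f (i, c) * cnj (B i a c) else 0)"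
      unfolding D' by (intro sum.cong) auto
    finally show "(\<Sum>kc\<in>UNIV. f kc * cnj (D (i, a) kc)) = (\<Sum>c\<in>UNIV. f (i, c) * cnj (B i a c))" by simp
  qed
  show ?thesis
    unfolding conjugate_by_def op_mult_def adj_def op_apply_def
    by (intro ext, clarsimp simp: delta)
       (simp add: sum_distrib_left sum_distrib_right cnj_sum mult_ac, intro sum.swap)
qed

section \<open>The circuit as a measure-and-prepare instrument\<close>

context heralding_coin
begin

definition "prep x = (if x = T1 then ket_s1 q else ket_s0 p)"

lemma unit_vector_ket: "unit_vector (ket_s0 p)" "unit_vector (ket_s1 q)"
  unfolding unit_vector_def using p q
  by (auto intro!: has_sum_finiteI simp: UNIV_trit ket_s0_def ket_s1_def ket_def)

lemma unit_vector_prep: "unit_vector (prep x)"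
  using unit_vector_ket by (simp add: prep_def)

text \<open>For control value \<open>i\<close> the ancilla passes from \<open>ket T0\<close> through
  \<open>ket_s0 p\<close> to \<open>prep i\<close>; the projection keeps \<open>i = x\<close> and
  the partial trace discards the control.\<close>

lemma M_plus_eq:
  assumes "op_apply Vp (ket T0) = ket_s0 p" "op_apply Vq (op_apply Vp (ket T0)) = ket_s1 q"
  shows "M_plus Vp Vq x \<rho> = (\<lambda>i j. \<rho> x x * ketbra (prep x) (prep x) i j)"
proof -
  have "tensor \<rho> (ketbra (ket T0) (ket T0)) =
      (\<lambda>(i, a) (j, b). \<rho> i j * ket T0 a * cnj (ket T0 b))"
    by (auto simp: tensor_def ketbra_def fun_eq_iff)
  moreover have "tensor op_id Vp = (\<lambda>(w, a) (w', b). if w = w' then Vp a b else 0)"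
    by (auto simp: tensor_def op_id_def fun_eq_iff)
  note conjugate_by_block_diagonal[OF this, of \<rho> "\<lambda>_. ket T0"]
  moreover have op_id: "op_apply op_id v = v" for v :: "trit vec"
    by (simp add: op_apply_def op_id_def if_distrib[of "\<lambda>x. x * _"] cong: if_cong)
  \<comment> \<open>Only \<open>T1\<close> has an odd value, so \<open>Vq\<close> acts exactly after
    the output that leads to \<open>s1_plus\<close>.\<close>
  have "op_apply (op_pow Vq (trit_val w mod 2)) (ket_s0 p) = prep w" for w
  proof -
    have "op_mult Vq op_id = Vq"
      by (simp add: op_mult_def op_id_def if_distrib[of "\<lambda>x. _ * x"] cong: if_cong)
    then show ?thesis using assms
      by (cases w) (simp_all add: op_pow_def op_id prep_def)
  qed
  note conj2 = conjugate_by_block_diagonal[OF controlled_mod2_def, of Vq \<rho> "\<lambda>_. ket_s0 p", unfolded this]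
  have "tensor (ketbra (ket x) (ket x)) op_id =
      (\<lambda>(w, a) (w', b). if w = w' then (if w = x then op_id a b else 0) else 0)"
    by (auto simp: tensor_def ketbra_def ket_def fun_eq_iff)
  note conj3 = conjugate_by_block_diagonal[OF this, of \<rho> prep]
  ultimately have "M_plus Vp Vq x \<rho> = (\<lambda>a b. \<Sum>i\<in>UNIV. \<rho> i i
      * op_apply (\<lambda>a b. if i = x then op_id a b else 0) (prep i) a
      * cnj (op_apply (\<lambda>a b. if i = x then op_id a b else 0) (prep i) b))"
    unfolding M_plus_def Let_def using assms(1) conj2 conj3
    by (simp add: partial_trace_fst_def)
  also have "\<dots> = (\<lambda>a b. \<Sum>i\<in>UNIV. if i = x then \<rho> x x * ketbra (prep x) (prep x) a b else 0)"
    by (intro ext sum.cong refl) (auto simp: op_id ketbra_def op_apply_def[of "\<lambda>_ _. 0"])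
  finally show ?thesis by simp
qed

lemma \<epsilon>_plus_past: "h \<in> pasts M \<Longrightarrow> \<epsilon>_plus p q M h = prep (h 0)"
  by (simp add: \<epsilon>_plus_def prep_def s1_plus_def)

lemma quantum_model_Q_plus:
  assumes V: "op_apply Vp (ket T0) = ket_s0 p" "op_apply Vq (op_apply Vp (ket T0)) = ket_s1 q"
  shows "quantum_model M (Q_plus p q M Vp Vq)"
proof -
  have "M_plus Vp Vq = (\<lambda>x A i j. A x x * ketbra (prep x) (prep x) i j)"
    using M_plus_eq[OF V] by (intro ext) simp
  then have inst: "quantum_instrument (M_plus Vp Vq)"
    using quantum_instrument_measure_prepare[of prep, OF unit_vector_prep] by simp
  have meas: "set_borel_measurable \<mu> (pasts M) (\<lambda>h. \<epsilon>_plus p q M h i)" for i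
  proof -
    have "(\<lambda>h. indicator (s0_plus M) h *\<^sub>R ket_s0 p i + indicator (s1_plus M) h *\<^sub>R ket_s1 q i)
        \<in> borel_measurable \<mu>"
      using causal_state_measurable by measurable
    also have "(\<lambda>h. indicator (s0_plus M) h *\<^sub>R ket_s0 p i + indicator (s1_plus M) h *\<^sub>R ket_s1 q i)
        = (\<lambda>h. indicator (pasts M) h *\<^sub>R \<epsilon>_plus p q M h i)"
      by (auto simp: \<epsilon>_plus_def s0_plus_def s1_plus_def indicator_def fun_eq_iff)
    finally show ?thesis unfolding set_borel_measurable_def .
  qed
  have step: "tr (M_plus Vp Vq x (ketbra (\<epsilon>_plus p q M h) (\<epsilon>_plus p q M h))) = complex_of_real (cond_future M h [x])
      \<and> (0 < cond_future M h [x] \<longrightarrow>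
         (\<lambda>i j. M_plus Vp Vq x (ketbra (\<epsilon>_plus p q M h) (\<epsilon>_plus p q M h)) i j
            / tr (M_plus Vp Vq x (ketbra (\<epsilon>_plus p q M h) (\<epsilon>_plus p q M h)))) =
         ketbra (\<epsilon>_plus p q M (past_snoc h x)) (\<epsilon>_plus p q M (past_snoc h x)))"
    if h: "h \<in> pasts M" for h x
  proof -
    \<comment> \<open>The amplitudes of the memory states are the square roots of the emission
      probabilities.\<close>
    have amp: "ketbra (prep (h 0)) (prep (h 0)) x x = complex_of_real (cond_future M h [x])"
      unfolding cond_future_heralding[OF proc h] emit_prob_single using p q
      by (cases x; cases "h 0")
         (auto simp: ketbra_def prep_def ket_s0_def ket_s1_def ket_def simp flip: of_real_mult)
    have tr: "tr (M_plus Vp Vq x (ketbra (\<epsilon>_plus p q M h) (\<epsilon>_plus p q M h))) = complex_of_real (cond_future M h [x])"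
      unfolding M_plus_eq[OF V] tr_cmult tr_ketbra_unit[OF unit_vector_prep] \<epsilon>_plus_past[OF h] amp by simp
    \<comment> \<open>The last output alone determines the new causal state, so the extended past is
      encoded by \<open>prep x\<close>.\<close>
    have "past_snoc h x 0 = x" by (simp add: past_snoc_def)
    then show ?thesis
      unfolding tr unfolding M_plus_eq[OF V] \<epsilon>_plus_past[OF h] amp
      using \<epsilon>_plus_past[OF past_snoc_in_pasts[OF h, of x]] by auto
  qed
  have "\<forall>h\<in>pasts M. \<epsilon>_plus p q M h \<in> \<Omega>_plus p q"
    by (auto simp: \<epsilon>_plus_def \<Omega>_plus_def)
  moreover have "\<forall>\<psi>\<in>\<Omega>_plus p q. unit_vector \<psi>"
    using unit_vector_ket by (auto simp: \<Omega>_plus_def)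
  ultimately show ?thesis
    unfolding quantum_model_def Q_plus_def prod.case using inst meas step by blast
qed

end

section \<open>Arbitrary quantum models\<close>

context heralding_coin
begin

text \<open>The pairwise bound is averaged first over \<open>h\<close> in \<open>s0_plus M\<close>
  for fixed \<open>h'\<close>, then over \<open>h'\<close> in \<open>s1_plus M\<close>. The factors
  \<open>w0\<close> and \<open>w1\<close> cancel against the measures of these sets.\<close>

lemma set_integral_pasts_le:
  fixes \<phi> :: "trit past \<Rightarrow> real"
  assumes int: "set_integrable \<mu> (pasts M) \<phi>"
    and le: "\<And>h h'. h \<in> s0_plus M \<Longrightarrow> h' \<in> s1_plus M \<Longrightarrow> w0 * \<phi> h + w1 * \<phi> h' \<le> B"
  shows "(LINT h:pasts M|\<mu>. \<phi> h) \<le> B"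
proof -
  have pasts: "pasts M = s0_plus M \<union> s1_plus M" and disj: "s0_plus M \<inter> s1_plus M = {}"
    by (auto simp: s0_plus_def s1_plus_def)
  have const: "set_integrable \<mu> A (\<lambda>_. c)" if "A \<in> sets \<mu>" for A and c :: real
    using that unfolding set_integrable_def by (simp add: \<mu>.emeasure_eq_measure)
  have int0: "set_integrable \<mu> (s0_plus M) \<phi>" and int1: "set_integrable \<mu> (s1_plus M) \<phi>"
    using causal_state_measurable pasts by (auto intro: set_integrable_subset[OF int])
  let ?I = "LINT h:s0_plus M|\<mu>. \<phi> h"
  have "\<phi> h' \<le> (B - ?I) / w1" if h': "h' \<in> s1_plus M" for h'
  proof -
    have "?I \<le> (LINT h:s0_plus M|\<mu>. (B - w1 * \<phi> h') / w0)"
    proof (rule set_integral_mono[OF int0 const])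
      show "\<phi> h \<le> (B - w1 * \<phi> h') / w0" if "h \<in> s0_plus M" for h
        using le[OF that h'] weights by (simp add: pos_le_divide_eq algebra_simps)
    qed (rule causal_state_measurable)
    also have "\<dots> = B - w1 * \<phi> h'"
      using weights measure_causal_state causal_state_measurable
      by (simp add: set_integral_const \<mu>.emeasure_eq_measure)
    finally show ?thesis using weights by (simp add: pos_le_divide_eq algebra_simps)
  qed
  then have "(LINT h:s1_plus M|\<mu>. \<phi> h) \<le> (LINT h:s1_plus M|\<mu>. (B - ?I) / w1)"
    by (intro set_integral_mono int1 const causal_state_measurable)
  also have "\<dots> = B - ?I"
    using weights measure_causal_state causal_state_measurable
    by (simp add: set_integral_const \<mu>.emeasure_eq_measure)
  finally show ?thesis
    unfolding pasts set_integral_Un[OF disj int0 int1] by simp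
qed

section \<open>The average state of a competing model\<close>

context
  fixes f :: "trit past \<Rightarrow> 'i::countable vec" and \<Omega> E
  assumes model: "quantum_model M (f, \<Omega>, E)"
begin

lemma model_unit_vector: "h \<in> pasts M \<Longrightarrow> unit_vector (f h)"
  using model unfolding quantum_model_def by auto

lemma model_measurable: "(\<lambda>h. indicator (pasts M) h *\<^sub>R f h i) \<in> borel_measurable \<mu>"
  using model unfolding quantum_model_def set_borel_measurable_def by auto

lemma model_overlap:
  assumes h: "h \<in> s0_plus M" "h' \<in> s1_plus M"
  shows "cmod (tr (ketbra (f h) (f h'))) \<le> sqrt (p * (1 - q))"
proof -
  have pasts: "h \<in> pasts M" "h' \<in> pasts M" and st: "st (h 0) = S0" "st (h' 0) = S1"
    using h by (auto simp: s0_plus_def s1_plus_def) (cases "h 0"; simp)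
  have "cmod (tr (ketbra (f h) (f h')))
      \<le> (\<Sum>x\<in>UNIV. sqrt (cond_future M h [x] * cond_future M h' [x]))"
    using model pasts unfolding quantum_model_def
    by (intro instrument_overlap_bound[of E] model_unit_vector) auto
  \<comment> \<open>Output \<open>T0\<close> has probability 0 from \<open>S1\<close> and
    \<open>T2\<close> has probability 0 from \<open>S0\<close>; only the term of \<open>T1\<close>
    survives.\<close>
  also have "\<dots> = sqrt (p * (1 - q))"
    unfolding cond_future_heralding[OF proc pasts(1)] cond_future_heralding[OF proc pasts(2)]
      emit_prob_single st
    by (simp add: UNIV_trit)
  finally show ?thesis .
qed

lemma model_integrable:
  "set_integrable \<mu> (pasts M) (\<lambda>h. ketbra (f h) (f h) i j)"
  unfolding set_integrable_def
proof (rule \<mu>.integrable_const_bound[of _ 1])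
  show "AE h in \<mu>. norm (indicator (pasts M) h *\<^sub>R ketbra (f h) (f h) i j) \<le> 1"
    using unit_vector_cmod_le_1[OF model_unit_vector]
    by (intro AE_I2) (auto simp: indicator_def ketbra_def norm_mult intro!: mult_le_one)
  have "(\<lambda>h. (indicator (pasts M) h *\<^sub>R f h i) * cnj (indicator (pasts M) h *\<^sub>R f h j)) \<in> borel_measurable \<mu>"
    by (intro borel_measurable_times borel_measurable_continuous_on[of cnj] model_measurable
        continuous_intros)
  also have "(\<lambda>h. (indicator (pasts M) h *\<^sub>R f h i) * cnj (indicator (pasts M) h *\<^sub>R f h j))
      = (\<lambda>h. indicator (pasts M) h *\<^sub>R ketbra (f h) (f h) i j)"
    by (auto simp: indicator_def ketbra_def)
  finally show "(\<lambda>h. indicator (pasts M) h *\<^sub>R ketbra (f h) (f h) i j) \<in> borel_measurable \<mu>" .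
qed

text \<open>Finite sums commute with the integral over pasts, so expectations of the memory state
  are averages of squared overlaps.\<close>

lemma memory_state_form:
  fixes F :: "'i set"
  shows "set_integrable \<mu> (pasts M) (\<lambda>h. (cmod (\<Sum>i\<in>F. cnj (v i) * f h i))\<^sup>2)" (is ?int)
    and "(\<Sum>i\<in>F. \<Sum>j\<in>F. cnj (v i) * memory_state M f i j * v j)
      = complex_of_real (LINT h:pasts M|\<mu>. (cmod (\<Sum>i\<in>F. cnj (v i) * f h i))\<^sup>2)" (is ?eq)
proof -
  let ?K = "\<lambda>h i j. cnj (v i) * (indicator (pasts M) h *\<^sub>R ketbra (f h) (f h) i j) * v j"
  have K: "integrable \<mu> (\<lambda>h. ?K h i j)" for i j
    using model_integrable[of i j] unfolding set_integrable_def
    by (intro integrable_mult_left integrable_mult_right)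
  have eq: "(\<Sum>i\<in>F. \<Sum>j\<in>F. ?K h i j)
      = complex_of_real (indicator (pasts M) h *\<^sub>R (cmod (\<Sum>i\<in>F. cnj (v i) * f h i))\<^sup>2)" for h
    using ketbra_form[where F=F and c=v and \<psi>="f h"] by (cases "h \<in> pasts M") auto
  have int: "integrable \<mu> (\<lambda>h. \<Sum>i\<in>F. \<Sum>j\<in>F. ?K h i j)"
    by (intro Bochner_Integration.integrable_sum K)
  then show ?int
    unfolding eq set_integrable_def using complex_of_real_integrable_eq by blast
  have "(\<Sum>i\<in>F. \<Sum>j\<in>F. cnj (v i) * memory_state M f i j * v j) = (\<Sum>i\<in>F. \<Sum>j\<in>F. (LINT h|\<mu>. ?K h i j))"
    by (simp only: memory_state_def set_lebesgue_integral_def integral_mult_left_zero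
        integral_mult_right_zero)
  also have "\<dots> = (LINT h|\<mu>. (\<Sum>i\<in>F. \<Sum>j\<in>F. ?K h i j))"
    by (simp only: Bochner_Integration.integral_sum Bochner_Integration.integrable_sum K)
  also have "\<dots> = complex_of_real (LINT h:pasts M|\<mu>. (cmod (\<Sum>i\<in>F. cnj (v i) * f h i))\<^sup>2)"
    unfolding eq set_lebesgue_integral_def by (rule integral_complex_of_real)
  finally show ?eq .
qed

lemma memory_state_diag:
  "set_integrable \<mu> (pasts M) (\<lambda>h. (cmod (f h i))\<^sup>2)"
  "Re (memory_state M f i i) = (LINT h:pasts M|\<mu>. (cmod (f h i))\<^sup>2)"
  using memory_state_form[where F="{i}" and v="\<lambda>_. 1"] by simp_all

text \<open>By Tonelli the trace is the average squared norm of the encoding, and almost every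
  sequence is a past, encoded by a unit vector.\<close>

lemma memory_state_trace: "((\<lambda>i. Re (memory_state M f i i)) has_sum 1) UNIV"
proof -
  let ?g = "\<lambda>i h. ennreal (indicator (pasts M) h *\<^sub>R (cmod (f h i))\<^sup>2)"
  have nonneg: "0 \<le> Re (memory_state M f i i)" for i
    unfolding memory_state_diag set_lebesgue_integral_def by (rule Bochner_Integration.integral_nonneg) simp
  have "(\<integral>\<^sup>+i. ennreal (Re (memory_state M f i i)) \<partial>count_space UNIV)
      = (\<integral>\<^sup>+i. \<integral>\<^sup>+h. ?g i h \<partial>\<mu> \<partial>count_space UNIV)"
    using memory_state_diag(1) unfolding memory_state_diag(2) set_lebesgue_integral_def set_integrable_def
    by (intro nn_integral_cong nn_integral_eq_integral[symmetric]) auto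
  also have "\<dots> = (\<integral>\<^sup>+h. \<integral>\<^sup>+i. ?g i h \<partial>count_space UNIV \<partial>\<mu>)"
    using memory_state_diag(1) unfolding set_integrable_def
    by (intro nn_integral_count_space_nn_integral[symmetric]) auto
  also have "\<dots> = (\<integral>\<^sup>+h. 1 \<partial>\<mu>)"
  proof (rule nn_integral_cong_AE)
    show "AE h in \<mu>. (\<integral>\<^sup>+i. ?g i h \<partial>count_space UNIV) = 1"
      using AE_pasts
    proof eventually_elim
      case (elim h)
      then have "((\<lambda>i. (cmod (f h i))\<^sup>2) has_sum 1) UNIV"
        using model_unit_vector unfolding unit_vector_def by blast
      then show ?case
        using elim by (subst (asm) has_sum_nonneg_iff_nn_integral) auto
    qed
  qed
  also have "\<dots> = ennreal 1" by (simp add: \<mu>.emeasure_space_1)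
  finally show ?thesis using nonneg by (subst has_sum_nonneg_iff_nn_integral) auto
qed

text \<open>The bound is shown for each spectral decomposition and passes to the infimum.\<close>

lemma binary_entropy_le_C_q:
  assumes m: "1 / 2 \<le> m" "m < 1" "m * (1 - m) = w0 * w1 * (1 - p * (1 - q))"
  shows "ennreal (binary_entropy m) \<le> C_q M (f, \<Omega>, E)"
  unfolding C_q_def von_neumann_entropy_def
proof (rule Inf_greatest, clarsimp)
  fix lam and e :: "'i \<Rightarrow> 'i vec"
  assume spec: "spectral_decomposition (memory_state M f) lam e"
  have "lam k \<le> m" for k
  proof (rule spectral_eigenvalue_le[OF spec])
    fix F :: "'i set" and v :: "'i vec"
    assume F: "finite F"
    have "(LINT h:pasts M|\<mu>. (cmod (\<Sum>i\<in>F. cnj (v i) * f h i))\<^sup>2) \<le> m * (\<Sum>i\<in>F. (cmod (v i))\<^sup>2)"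
    proof (rule set_integral_pasts_le[OF memory_state_form(1)])
      fix h h' assume h: "h \<in> s0_plus M" "h' \<in> s1_plus M"
      then have "unit_vector (f h)" "unit_vector (f h')"
        by (auto intro!: model_unit_vector simp: s0_plus_def s1_plus_def)
      then show "w0 * (cmod (\<Sum>i\<in>F. cnj (v i) * f h i))\<^sup>2 + w1 * (cmod (\<Sum>i\<in>F. cnj (v i) * f h' i))\<^sup>2
          \<le> m * (\<Sum>i\<in>F. (cmod (v i))\<^sup>2)"
        by (rule two_state_expectation_bound[OF _ _ model_overlap[OF h]])
           (use F m weights p q in auto)
    qed
    then show "Re (\<Sum>i\<in>F. \<Sum>j\<in>F. cnj (v i) * memory_state M f i j * v j) \<le> m * (\<Sum>i\<in>F. (cmod (v i))\<^sup>2)"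
      unfolding memory_state_form(2) by simp
  qed (use m in auto)
  moreover have "0 \<le> lam k" for k
    using spec unfolding spectral_decomposition_def by blast
  moreover have "(lam has_sum 1) UNIV"
    by (rule spectral_eigenvalues_sum[OF spec memory_state_trace])
  ultimately show "ennreal (binary_entropy m) \<le> (\<Sum>\<^sub>\<infinity>k. ennreal (- (lam k * log 2 (lam k))))"
    using m by (intro binary_entropy_le_entropy)
qed

end

end

section \<open>The spectrum of the memory state\<close>

lemma orthonormal_normalized:
  fixes R :: "'k \<Rightarrow> 'i::finite \<Rightarrow> real"
  assumes n: "\<And>k. 0 < n k"
    and R: "\<And>k l. (\<Sum>i\<in>UNIV. R k i * R l i) = (if k = l then n k else 0)"
  shows "orthonormal (\<lambda>k i. complex_of_real (R k i / sqrt (n k)))"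
  unfolding orthonormal_def
proof (intro allI has_sum_finiteI)
  fix k l
  have "(\<Sum>i\<in>UNIV. cnj (complex_of_real (R k i / sqrt (n k))) * complex_of_real (R l i / sqrt (n l)))
      = complex_of_real ((\<Sum>i\<in>UNIV. R k i * R l i) / (sqrt (n k) * sqrt (n l)))"
    by (simp add: sum_divide_distrib)
  also have "\<dots> = (if k = l then 1 else 0)"
  proof -
    have "(\<Sum>i\<in>UNIV. R k i * R l i) / (sqrt (n k) * sqrt (n l)) = (if k = l then 1 else 0)"
      using n[of k] by (auto simp: R)
    then show ?thesis by (simp only: of_real_1 of_real_0 if_distrib[of complex_of_real])
  qed
  finally show "(if k = l then 1 else 0) =
      (\<Sum>i\<in>UNIV. cnj (complex_of_real (R k i / sqrt (n k))) * complex_of_real (R l i / sqrt (n l)))"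
    by (rule sym)
qed simp

text \<open>The Jacobi rotation that makes two vectors with Gram matrix \<open>(x, g; g, x + u)\<close> orthogonal.\<close>

lemma ex_jacobi_rotation:
  fixes u g :: real
  shows "\<exists>a b. a\<^sup>2 + b\<^sup>2 = 1 \<and> a * b * u + (a\<^sup>2 - b\<^sup>2) * g = 0"
proof (cases "u = 0 \<and> g = 0")
  case True
  then show ?thesis by (intro exI[of _ 1] exI[of _ 0]) simp
next
  case False
  define r where "r = sqrt (u\<^sup>2 + (2 * g)\<^sup>2)"
  have pos: "0 < u\<^sup>2 + (2 * g)\<^sup>2" unfolding sum_power2_gt_zero_iff using False by simp
  then have r: "0 < r" "r\<^sup>2 = u\<^sup>2 + (2 * g)\<^sup>2" by (simp_all add: r_def)
  have "(u / r)\<^sup>2 + (- 2 * g / r)\<^sup>2 = (u\<^sup>2 + (2 * g)\<^sup>2) / r\<^sup>2"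
    by (simp add: power_divide add_divide_distrib)
  also have "\<dots> = 1" unfolding r(2)[symmetric] using r(1) by simp
  finally have "(u / r)\<^sup>2 + (- 2 * g / r)\<^sup>2 = 1" .
  \<comment> \<open>The rotation angle is \<open>t / 2\<close>: in double angles the required
    equation is linear in \<open>cos t\<close> and \<open>sin t\<close>, and this point of the unit
    circle solves it.\<close>
  then obtain t where t: "u / r = cos t" "- 2 * g / r = sin t"
    using sincos_total_2pi by metis
  have double_sin: "cos (t / 2) * sin (t / 2) = sin t / 2"
    using sin_double[of "t / 2"] by simp
  have double_cos: "(cos (t / 2))\<^sup>2 - (sin (t / 2))\<^sup>2 = cos t"
    using cos_double[of "t / 2"] by simp
  have "sin t / 2 * u + cos t * g = 0" by (simp flip: t)
  then have "(cos (t / 2))\<^sup>2 + (sin (t / 2))\<^sup>2 = 1 \<and> cos (t / 2) * sin (t / 2) * u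
      + ((cos (t / 2))\<^sup>2 - (sin (t / 2))\<^sup>2) * g = 0"
    unfolding double_sin double_cos by simp
  then show ?thesis by blast
qed

text \<open>\<open>X\<close> and \<open>Y\<close> are the weighted memory vectors. Rotating the pair
  does not change the sum of their rank-one operators, and the Jacobi rotation makes them
  orthogonal. They are then eigenvectors, with their squared lengths as eigenvalues;
  \<open>d\<close> is the Gram determinant.\<close>

lemma two_state_spectral_decomposition:
  fixes x0 x1 y1 y2 :: real
  defines "d \<equiv> (x0\<^sup>2 + x1\<^sup>2) * (y1\<^sup>2 + y2\<^sup>2) - (x1 * y1)\<^sup>2"
  defines "X \<equiv> \<lambda>i. case i of T0 \<Rightarrow> x0 | T1 \<Rightarrow> x1 | T2 \<Rightarrow> 0"
    and "Y \<equiv> \<lambda>i. case i of T0 \<Rightarrow> 0 | T1 \<Rightarrow> y1 | T2 \<Rightarrow> y2"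
  assumes tr: "x0\<^sup>2 + x1\<^sup>2 + y1\<^sup>2 + y2\<^sup>2 = 1" and d: "0 < d"
  obtains l1 l2 e where "l1 + l2 = 1" "l1 * l2 = d" "0 < l1" "0 < l2"
    "spectral_decomposition (\<lambda>i j. complex_of_real (X i * X j + Y i * Y j))
      (case_trit l1 l2 0) e"
proof -
  obtain a b where ab: "a\<^sup>2 + b\<^sup>2 = 1"
    "a * b * ((y1\<^sup>2 + y2\<^sup>2) - (x0\<^sup>2 + x1\<^sup>2)) + (a\<^sup>2 - b\<^sup>2) * (x1 * y1) = 0"
    using ex_jacobi_rotation by blast
  \<comment> \<open>The third vector is the cross product of the first two, whose length is given by Lagrange's identity.\<close>
  define R :: "trit \<Rightarrow> trit \<Rightarrow> real" where
    "R = case_trit (\<lambda>i. a * X i + b * Y i) (\<lambda>i. a * Y i - b * X i)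
      (case_trit (x1 * y2) (- x0 * y2) (x0 * y1))"
  define l1 l2 where "l1 = (\<Sum>i\<in>UNIV. (R T0 i)\<^sup>2)" and "l2 = (\<Sum>i\<in>UNIV. (R T1 i)\<^sup>2)"
  have l: "l1 = (a * x0)\<^sup>2 + (a * x1 + b * y1)\<^sup>2 + (b * y2)\<^sup>2"
    "l2 = (b * x0)\<^sup>2 + (a * y1 - b * x1)\<^sup>2 + (a * y2)\<^sup>2"
    by (simp_all add: l1_def l2_def R_def UNIV_trit X_def Y_def add.assoc)
  have sum: "l1 + l2 = 1"
  proof -
    have "l1 + l2 = (a\<^sup>2 + b\<^sup>2) * (x0\<^sup>2 + x1\<^sup>2 + y1\<^sup>2 + y2\<^sup>2)" unfolding l by algebra
    then show ?thesis using ab tr by simp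
  qed
  have off: "a * x0 * (- b * x0) + (a * x1 + b * y1) * (a * y1 - b * x1) + b * y2 * (a * y2) = 0"
    using ab(2) by algebra
  have prod: "l1 * l2 = d"
  proof -
    \<comment> \<open>The Gram determinant is invariant under the rotation.\<close>
    have "l1 * l2 - (a * x0 * (- b * x0) + (a * x1 + b * y1) * (a * y1 - b * x1) + b * y2 * (a * y2))\<^sup>2
        = (a\<^sup>2 + b\<^sup>2)\<^sup>2 * d"
      unfolding l d_def by algebra
    then show ?thesis using off ab by simp
  qed
  have "0 \<le> l1" "0 \<le> l2" unfolding l by auto
  then have pos: "0 < l1" "0 < l2" using prod d by (auto simp: less_le)
  \<comment> \<open>Squared lengths of the vectors; they agree with the eigenvalues except at
    \<open>T2\<close>, where the length squared is \<open>d\<close> and the eigenvalue 0.\<close>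
  define n where "n = case_trit l1 l2 d"
  define e where "e k i = complex_of_real (R k i / sqrt (n k))" for k i
  have "orthonormal (\<lambda>k i. complex_of_real (R k i / sqrt (n k)))"
  proof (rule orthonormal_normalized)
    show "0 < n k" for k using pos d by (cases k) (auto simp: n_def)
    show "(\<Sum>i\<in>UNIV. R k i * R l i) = (if k = l then n k else 0)" for k l
    proof -
      have "(\<Sum>i\<in>UNIV. R T0 i * R T0 i) = l1" "(\<Sum>i\<in>UNIV. R T1 i * R T1 i) = l2"
        by (simp_all add: l1_def l2_def power2_eq_square)
      moreover have "(\<Sum>i\<in>UNIV. R T2 i * R T2 i) = d"
        unfolding d_def by (simp add: R_def UNIV_trit) algebra
      moreover have "(\<Sum>i\<in>UNIV. R T0 i * R T1 i) = 0" "(\<Sum>i\<in>UNIV. R T1 i * R T0 i) = 0"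
        using off by (simp_all add: R_def UNIV_trit X_def Y_def algebra_simps)
      moreover have "(\<Sum>i\<in>UNIV. R T0 i * R T2 i) = 0" "(\<Sum>i\<in>UNIV. R T2 i * R T0 i) = 0"
        "(\<Sum>i\<in>UNIV. R T1 i * R T2 i) = 0" "(\<Sum>i\<in>UNIV. R T2 i * R T1 i) = 0"
        by (simp_all add: R_def UNIV_trit X_def Y_def algebra_simps)
      ultimately show ?thesis by (cases k; cases l) (simp_all add: n_def)
    qed
  qed
  then have orth: "orthonormal e" by (simp add: e_def[abs_def])
  have "spectral_decomposition (\<lambda>i j. complex_of_real (X i * X j + Y i * Y j)) (case_trit l1 l2 0) e"
    unfolding spectral_decomposition_def
  proof (intro conjI allI orth has_sum_finiteI)
    show "0 \<le> case_trit l1 l2 0 k" for k using pos by (cases k) auto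
    fix i j
    have "(\<Sum>k\<in>UNIV. complex_of_real (case_trit l1 l2 0 k) * ketbra (e k) (e k) i j)
        = complex_of_real (R T0 i * R T0 j + R T1 i * R T1 j)"
      using pos by (simp add: UNIV_trit ketbra_def e_def n_def flip: of_real_mult of_real_add of_real_divide)
    also have "R T0 i * R T0 j + R T1 i * R T1 j = (a\<^sup>2 + b\<^sup>2) * (X i * X j + Y i * Y j)"
      unfolding R_def trit.case by algebra
    finally show "complex_of_real (X i * X j + Y i * Y j)
        = (\<Sum>k\<in>UNIV. complex_of_real (case_trit l1 l2 0 k) * ketbra (e k) (e k) i j)"
      using ab by simp
  qed simp
  then show ?thesis using that sum prod pos by blast
qed

section \<open>Entropy of the heralding model and comparison\<close>

context heralding_coin
begin

lemma memory_state_Q_plus: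
  "memory_state M (\<epsilon>_plus p q M) = (\<lambda>i j. w0 * ketbra (ket_s0 p) (ket_s0 p) i j + w1 * ketbra (ket_s1 q) (ket_s1 q) i j)"
proof (intro ext)
  fix i j
  have "memory_state M (\<epsilon>_plus p q M) i j =
      (LINT h|\<mu>. indicator (s0_plus M) h *\<^sub>R ketbra (ket_s0 p) (ket_s0 p) i j
        + indicator (s1_plus M) h *\<^sub>R ketbra (ket_s1 q) (ket_s1 q) i j)"
    unfolding memory_state_def set_lebesgue_integral_def
    by (intro Bochner_Integration.integral_cong refl)
       (auto simp: \<epsilon>_plus_def s0_plus_def s1_plus_def indicator_def)
  also have "\<dots> = w0 *\<^sub>R ketbra (ket_s0 p) (ket_s0 p) i j + w1 *\<^sub>R ketbra (ket_s1 q) (ket_s1 q) i j"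
    using causal_state_measurable measure_causal_state
    by (subst Bochner_Integration.integral_add) (auto simp: \<mu>.emeasure_eq_measure)
  finally show "memory_state M (\<epsilon>_plus p q M) i j =
      w0 * ketbra (ket_s0 p) (ket_s0 p) i j + w1 * ketbra (ket_s1 q) (ket_s1 q) i j"
    by (simp add: scaleR_conv_of_real)
qed

text \<open>One explicit spectral decomposition bounds the infimum from above, and \<open>m\<close>
  is its larger eigenvalue.\<close>

lemma C_q_Q_plus_le:
  obtains m where "1 / 2 \<le> m" "m < 1" "m * (1 - m) = w0 * w1 * (1 - p * (1 - q))"
    "C_q M (Q_plus p q M Vp Vq) \<le> ennreal (binary_entropy m)"
proof -
  \<comment> \<open>Coordinates of the two memory vectors, each scaled by the square root of its
    weight.\<close>
  let ?x0 = "sqrt w0 * sqrt (1 - p)" and ?x1 = "sqrt w0 * sqrt p"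
  let ?y1 = "sqrt w1 * sqrt (1 - q)" and ?y2 = "sqrt w1 * sqrt q"
  let ?X = "\<lambda>i. case i of T0 \<Rightarrow> ?x0 | T1 \<Rightarrow> ?x1 | T2 \<Rightarrow> 0"
  let ?Y = "\<lambda>i. case i of T0 \<Rightarrow> 0 | T1 \<Rightarrow> ?y1 | T2 \<Rightarrow> ?y2"
  have sq: "?x0\<^sup>2 + ?x1\<^sup>2 = w0" "?y1\<^sup>2 + ?y2\<^sup>2 = w1" "(?x1 * ?y1)\<^sup>2 = w0 * w1 * (p * (1 - q))"
    using p q weights by (simp_all add: power_mult_distrib algebra_simps)
  have det: "(?x0\<^sup>2 + ?x1\<^sup>2) * (?y1\<^sup>2 + ?y2\<^sup>2) - (?x1 * ?y1)\<^sup>2 = w0 * w1 * (1 - p * (1 - q))"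
    unfolding sq by (simp add: algebra_simps)
  \<comment> \<open>As \<open>q > 0\<close>, the squared overlap stays below 1 and the Gram
    determinant is positive.\<close>
  have "p * (1 - q) \<le> 1 * (1 - q)" using p q by (intro mult_right_mono) auto
  then have pos: "0 < w0 * w1 * (1 - p * (1 - q))" using q weights by simp
  have tr: "?x0\<^sup>2 + ?x1\<^sup>2 + ?y1\<^sup>2 + ?y2\<^sup>2 = 1" using sq weights by linarith
  obtain l1 l2 e where l: "l1 + l2 = 1" "l1 * l2 = w0 * w1 * (1 - p * (1 - q))" "0 < l1" "0 < l2"
    and spec: "spectral_decomposition (\<lambda>i j. complex_of_real (?X i * ?X j + ?Y i * ?Y j)) (case_trit l1 l2 0) e"
    using two_state_spectral_decomposition[of ?x0 ?x1 ?y1 ?y2, unfolded det, OF tr pos] by blast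
  have "(\<lambda>i j. complex_of_real (?X i * ?X j + ?Y i * ?Y j)) = memory_state M (\<epsilon>_plus p q M)"
  proof (intro ext)
    fix i j
    have vec: "complex_of_real (?X i) = sqrt w0 * ket_s0 p i" "complex_of_real (?Y i) = sqrt w1 * ket_s1 q i" for i
      by (cases i; simp add: ket_s0_def ket_s1_def ket_def)+
    have real: "cnj (ket_s0 p i) = ket_s0 p i" "cnj (ket_s1 q i) = ket_s1 q i" for i
      by (simp_all add: ket_s0_def ket_s1_def ket_def)
    have w: "complex_of_real w0 = sqrt w0 * sqrt w0" "complex_of_real w1 = sqrt w1 * sqrt w1"
      using weights by (simp_all flip: of_real_mult)
    show "complex_of_real (?X i * ?X j + ?Y i * ?Y j) = memory_state M (\<epsilon>_plus p q M) i j"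
      unfolding memory_state_Q_plus ketbra_def real w of_real_add of_real_mult vec
      by (simp only: mult_ac)
  qed
  note spec = spec[unfolded this]
  have l2: "l2 = 1 - l1" using l by simp
  have "C_q M (Q_plus p q M Vp Vq) \<le> (\<Sum>\<^sub>\<infinity>k. ennreal (- (case_trit l1 l2 0 k * log 2 (case_trit l1 l2 0 k))))"
    unfolding C_q_def Q_plus_def fst_conv von_neumann_entropy_def
    using spec by (intro Inf_lower) blast
  also have "\<dots> = ennreal (- (l1 * log 2 l1)) + ennreal (- (l2 * log 2 l2))"
    by (simp add: UNIV_trit)
  also have "\<dots> = ennreal (binary_entropy l1)"
    using l unfolding l2 binary_entropy_def
    by (subst ennreal_plus[symmetric]) (auto simp: mult_nonneg_nonpos)
  finally have le: "C_q M (Q_plus p q M Vp Vq) \<le> ennreal (binary_entropy l1)" .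
  show ?thesis
  proof (cases "1 / 2 \<le> l1")
    case True
    then show ?thesis using that[of l1] l le by (simp add: l2)
  next
    case False
    then show ?thesis using that[of l2] l le by (simp add: l2 binary_entropy_flip mult.commute)
  qed
qed

text \<open>The upper bound for \<open>Q_plus\<close> and the lower bound for every competitor are
  the binary entropy of the same \<open>m\<close>.\<close>

lemma optimal_Q_plus:
  assumes "op_apply Vp (ket T0) = ket_s0 p" "op_apply Vq (op_apply Vp (ket T0)) = ket_s1 q"
  shows "optimal_quantum_model TYPE('j::countable) M (Q_plus p q M Vp Vq)"
  unfolding optimal_quantum_model_def
proof (intro conjI allI impI)
  show "quantum_model M (Q_plus p q M Vp Vq)"
    using assms by (rule quantum_model_Q_plus)
  fix Q' :: "(trit, 'j) qmodel"
  assume Q': "quantum_model M Q'"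
  obtain f \<Omega> E where eq: "Q' = (f, \<Omega>, E)" by (cases Q')
  obtain m where m: "1 / 2 \<le> m" "m < 1" "m * (1 - m) = w0 * w1 * (1 - p * (1 - q))"
    and le: "C_q M (Q_plus p q M Vp Vq) \<le> ennreal (binary_entropy m)"
    by (rule C_q_Q_plus_le)
  note le
  also have "ennreal (binary_entropy m) \<le> C_q M Q'"
    unfolding eq by (rule binary_entropy_le_C_q[OF Q'[unfolded eq] m])
  finally show "C_q M (Q_plus p q M Vp Vq) \<le> C_q M Q'" .
qed

end


theorem theorem1:
  fixes p q :: real and M :: "(int \<Rightarrow> trit) measure" and Vp Vq :: "trit op"
  assumes "0 < p" "p \<le> 1" "0 < q" "q \<le> 1"
    and "heralding_process p q M"
    and "unitary Vp" "unitary Vq"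
    and "op_apply Vp (ket T0) = ket_s0 p"
    and "op_apply Vq (op_apply Vp (ket T0)) = ket_s1 q"
  shows "optimal_quantum_model TYPE('j::countable) M (Q_plus p q M Vp Vq)"
proof -
  interpret heralding_coin p q M
    using assms by unfold_locales
  show ?thesis
    using assms by (intro optimal_Q_plus)
qed

end
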